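(* Let $k\geq 2$ be an integer and let $f(x_1,x_2,\ldots,x_k)=x_1x_2\cdots x_k+1$. Then the family of $k$-uniform hypergraphs $\mathcal{D}_k=\{Y_{f,q}: q \text{ is an odd prime power}\}$ is quasi-random.
   Context: $Y_{f,q}$ is the $k$-uniform hypergraph with vertex set the finite field $\mathbb{F}_q$ in which a $k$-element subset $\{a_1,\ldots,a_k\}\subset\mathbb{F}_q$ is an edge if and only if $f(a_1,\ldots,a_k)$ is a square in $\mathbb{F}_q$ ($0$ counts as a square). Even partial octahedra: the $k$-octahedron $\mathcal{O}_k$ is the $k$-uniform hypergraph on the $2k$ vertices $u_i(\varepsilon)$, $1\le i\le k$, $\varepsilon\in\{0,1\}$, whose edges are the $2^k$ sets $\{u_1(\varepsilon_1),\ldots,u_k(\varepsilon_k)\}$ with $\varepsilon_1,\ldots,\varepsilon_k\in\{0,1\}$. An even partial octahedron (EPO) is a $k$-uniform hypergraph on the same vertex set as $\mathcal{O}_k$ whose edge set meets the edge set of $\mathcal{O}_k$ in an even number of edges. $\mathcal{O}_k^e$ is the set of all EPOs on this vertex set. For $k$-uniform hypergraphs $G,H$, $N^*_G(H)$ is the number of labeled occurrences of $H$ as an induced subgraph of $G$ (i.e. injective maps $V(H)\to V(G)$ under which a $k$-subset of $V(H)$ is an edge of $H$ iff its image is an edge of $G$), and $N^*_G(\mathcal{O}_k^e)=\sum_{H\in\mathcal{O}_k^e}N^*_G(H)$. Thus $N^*_G(\mathcal{O}_k^e)$ is the number of $2k$-tuples of distinct vertices $(u_1(0),u_1(1),\ldots,u_k(0),u_k(1))$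 of $G$ such that an even number of the $2^k$ sets $\{u_1(\varepsilon_1),\ldots,u_k(\varepsilon_k)\}$ are edges of $G$. Quasi-random: a family $\mathcal{G}$ of $k$-uniform hypergraphs with unbounded number of vertices is quasi-random if $N^*_G(\mathcal{O}_k^e)\le (1+o(1))\frac{n^{2k}}{2}$ for $G\in\mathcal{G}$ as $n=|V(G)|\to\infty$ (the $o(1)$ being uniform over the members of $\mathcal{G}$ with $n$ vertices). *)

theory Defs
  imports
    Complex_Main
    "HOL-Library.FuncSet"
    "HOL-Number_Theory.Prime_Powers"
    "HOL-Algebra.Ring"
begin

record 'a hypergraph =
  verts :: "'a set"
  edges :: "'a set set"

definition k_uniform :: "nat \<Rightarrow> 'a hypergraph \<Rightarrow> bool" where
  "k_uniform k G \<longleftrightarrow>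
     finite (verts G) \<and> edges G \<subseteq> {e. e \<subseteq> verts G \<and> card e = k}"

text \<open>Embeddings are taken to be extensional, so that each one is counted exactly once.\<close>

definition induced_embeddings ::
    "nat \<Rightarrow> 'b hypergraph \<Rightarrow> 'a hypergraph \<Rightarrow> ('b \<Rightarrow> 'a) set" where
  "induced_embeddings k H G =
     {\<phi> \<in> verts H \<rightarrow>\<^sub>E verts G. inj_on \<phi> (verts H) \<and>
        (\<forall>S. S \<subseteq> verts H \<and> card S = k \<longrightarrow> (S \<in> edges H \<longleftrightarrow> \<phi> ` S \<in> edges G))}"

definition induced_count :: "nat \<Rightarrow> 'a hypergraph \<Rightarrow> 'b hypergraph \<Rightarrow> nat" where
  "induced_count k G H = card (induced_embeddings k H G)"

text \<open>The vertex \<open>u\<^sub>i(\<epsilon>)\<close> of the octahedron is the pair \<open>(i, \<epsilon>)\<close>.\<close>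

definition octahedron :: "nat \<Rightarrow> (nat \<times> nat) hypergraph" where
  "octahedron k =
     \<lparr>verts = {1..k} \<times> {0, 1},
      edges = {(\<lambda>i. (i, \<epsilon> i)) ` {1..k} |\<epsilon>. \<epsilon> \<in> {1..k} \<rightarrow> {0, 1}}\<rparr>"

definition even_partial_octahedra :: "nat \<Rightarrow> (nat \<times> nat) hypergraph set" where
  "even_partial_octahedra k =
     {H. k_uniform k H \<and> verts H = verts (octahedron k) \<and>
         even (card (edges H \<inter> edges (octahedron k)))}"

definition EPO_count :: "nat \<Rightarrow> 'a hypergraph \<Rightarrow> nat" where
  "EPO_count k G = (\<Sum>H\<in>even_partial_octahedra k. induced_count k G H)"

text \<open>The sequence \<open>\<delta>\<close> is the \<open>o(1)\<close> term; it depends only on the number of vertices.\<close>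

definition quasi_random :: "nat \<Rightarrow> 'a hypergraph set \<Rightarrow> bool" where
  "quasi_random k \<G> \<longleftrightarrow>
     (\<forall>G\<in>\<G>. k_uniform k G) \<and>
     (\<forall>N. \<exists>G\<in>\<G>. card (verts G) \<ge> N) \<and>
     (\<exists>\<delta> :: nat \<Rightarrow> real. \<delta> \<longlonglongrightarrow> 0 \<and>
        (\<forall>G\<in>\<G>. real (EPO_count k G) \<le>
           (1 + \<delta> (card (verts G))) * (real (card (verts G)) ^ (2 * k) / 2)))"

definition is_square_in :: "'a ring \<Rightarrow> 'a \<Rightarrow> bool" where
  "is_square_in F x \<longleftrightarrow> (\<exists>y\<in>carrier F. x = y \<otimes>\<^bsub>F\<^esub> y)"

text \<open>A function \<open>f\<close> of \<open>k\<close> variables takes a tuple \<open>a\<close> with entries \<open>a 1, \<dots>, a k\<close>. It is meant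
  to be symmetric, so that the choice of enumeration of an edge is irrelevant.\<close>

definition Y_hypergraph :: "nat \<Rightarrow> ((nat \<Rightarrow> 'a) \<Rightarrow> 'a) \<Rightarrow> 'a ring \<Rightarrow> 'a hypergraph" where
  "Y_hypergraph k f F =
     \<lparr>verts = carrier F,
      edges = {a ` {1..k} |a. a \<in> {1..k} \<rightarrow> carrier F \<and> inj_on a {1..k} \<and> is_square_in F (f a)}\<rparr>"

definition prod_plus_one :: "nat \<Rightarrow> 'a ring \<Rightarrow> (nat \<Rightarrow> 'a) \<Rightarrow> 'a" where
  "prod_plus_one k F a = (\<Otimes>\<^bsub>F\<^esub>i\<in>{1..k}. a i) \<oplus>\<^bsub>F\<^esub> \<one>\<^bsub>F\<^esub>"

text \<open>Since a finite field of order \<open>q\<close> is only determined up to isomorphism, every one whose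
  elements lie in the type \<open>'a\<close> contributes. If \<open>'a\<close> is infinite, each odd prime power \<open>q\<close>
  occurs as an order.\<close>

definition D_family :: "nat \<Rightarrow> 'a hypergraph set" where
  "D_family k =
     {Y_hypergraph k (prod_plus_one k F) F |F q.
        primepow q \<and> odd q \<and> field F \<and> finite (carrier F) \<and> card (carrier F) = q}"

end

theory Submission
  imports
    Defs
    "HOL-Algebra.Weak_Morphisms"
    "HOL-Number_Theory.Residues"
    "HOL-Library.Cardinality"
    "HOL-Computational_Algebra.Computational_Algebra"
begin

text \<open>
  Let $q = 2 m + 1$ be the number of elements of the field. Fix all vertices $u_i(\epsilon)$ of an
  octahedron except $x = u_1(0)$. Whether an edge through $x$ is present depends on whether
  $1 + w x$ is a square, where $w$ runs through the $2^{k-1}$ products of the other vertices of such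
  an edge. By Euler's criterion, an even number of edges means that $f(x)^m = c$, where $f$ is the
  product of the polynomials $1 + w X$ and $c = \pm 1$ depends on the fixed vertices alone. So it
  is enough that this equation has at most $q/2 + o(q)$ solutions, except for a proportion $O(1/q)$ of
  the choices of the fixed vertices (\<open>card_degenerate\<close>), which contribute $O(q^{2k-1})$
  tuples. Outside of these exceptions $f$ has a simple root and therefore is not a square.

  That $f(x)^m = c$ holds for about half of all $x$ follows from Weil's theorem on curves
  $y^2 = f(x)$. The bound \<open>stepanov_bound\<close> is an elementary substitute, due to Stepanov: there is
  a nonzero polynomial $P = \sum_{j < J} (r_j + s_j f^m) X^{qj}$, with $r_j$ and $s_j$ of degree less
  than about $q/2$, that vanishes to order $2 J - 1$ at every solution. At a solution, $X^q$ and $f^m$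
  behave to this order like polynomials of small degree. Hence the conditions are few in comparison
  with the free coefficients, and since they are additive, the pigeonhole principle over the finite
  field yields a solution (\<open>vanishing_conditions_solvable\<close>). That $P$ is not zero
  uses that $f$ is not a square (\<open>auxiliary_poly_nonzero\<close>). Comparing the degree of $P$
  with the number of its zeros bounds the number of solutions by $q (J + d) / (2 J - 1)$,
  where $d$ is a bound for the degree of $f$. For large $J$ this is close to $q / 2$.

  Polynomials are taken over a type of class \<open>finite_field\<close>, while the fields of the theorem are
  records with a carrier set. The passage from one to the other
  (\<open>few_even_tuples_finite_odd_field\<close>) turns a hypothetical counterexample into a type.
\<close>

hide_const (open) UnivPoly.coeff UnivPoly.monom Coset.order

section \<open>Frobenius and squares in finite fields\<close>

text \<open>
  The polynomial $(X + 1)^q - X^q - 1$ has degree less than $q$ and, because $x^q = x$ throughout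
  the field, vanishes at all $q$ elements. So it is the zero polynomial, and its coefficients are
  the binomial coefficients in question. This gives the Frobenius identity for the exponent $q$
  without writing $q$ as a power of the characteristic.
\<close>
lemma of_nat_card_choose_eq_0:
  assumes "0 < i" "i < CARD('a::finite_field)"
  shows "(of_nat (CARD('a) choose i) :: 'a) = 0"
proof -
  define q where "q = CARD('a)"
  define p :: "'a poly" where "p = (\<Sum>i\<in>{1..<q}. monom (of_nat (q choose i)) i)"
  have q: "q > 0" unfolding q_def by simp
  have "poly p x = 0" for x
  proof -
    have "(x + 1) ^ q = (\<Sum>k\<le>q. of_nat (q choose k) * x ^ k * 1 ^ (q - k))"
      by (rule binomial_ring)
    also have "{..q} = insert 0 (insert q {1..<q})" using q by auto
    also have "(\<Sum>k\<in>insert 0 (insert q {1..<q}). of_nat (q choose k) * x ^ k * 1 ^ (q - k))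
        = 1 + (x ^ q + poly p x)"
      using q by (simp add: p_def poly_sum poly_monom)
    finally show ?thesis
      unfolding q_def by (simp add: finite_field_power_card_eq_same)
  qed
  moreover have "degree p < q"
  proof -
    have "degree p \<le> q - 1"
      unfolding p_def by (intro degree_sum_le) (auto intro: order.trans[OF degree_monom_le])
    thus ?thesis using q by simp
  qed
  ultimately have "p = 0"
    using card_poly_roots_bound[of p] by (force simp: q_def)
  hence "coeff p i = 0" by simp
  thus ?thesis
    using assms by (simp add: p_def coeff_sum q_def if_distrib sum.delta cong: if_cong)
qed

lemma poly_power_card_add:
  fixes u v :: "'a::finite_field poly"
  shows "(u + v) ^ CARD('a) = u ^ CARD('a) + v ^ CARD('a)"
proof -
  define q where "q = CARD('a)"
  have q: "q > 0" unfolding q_def by simp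
  have "(u + v) ^ q = (\<Sum>k\<le>q. of_nat (q choose k) * u ^ k * v ^ (q - k))"
    by (rule binomial_ring)
  also have "\<dots> = (\<Sum>k\<in>{0, q}. of_nat (q choose k) * u ^ k * v ^ (q - k))"
  proof (intro sum.mono_neutral_right ballI)
    fix k assume "k \<in> {..q} - {0, q}"
    hence "of_nat (q choose k) = (0 :: 'a)"
      unfolding q_def by (intro of_nat_card_choose_eq_0) auto
    hence "of_nat (q choose k) = (0 :: 'a poly)"
      by (simp add: of_nat_poly)
    thus "of_nat (q choose k) * u ^ k * v ^ (q - k) = 0" by simp
  qed auto
  finally show ?thesis using q by (simp add: q_def add_ac)
qed

text \<open>
  Squaring is at most two-to-one on the $2m$ nonzero elements, so there are at least $m$ nonzero
  squares. They are roots of $X^m - 1$, which has at most $m$ roots, so no nonsquare is a root.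
\<close>
lemma euler_criterion_finite_field:
  fixes x :: "'a::finite_field"
  assumes m: "CARD('a) = 2 * m + 1" and "x \<noteq> 0"
  shows "x ^ m = (if \<exists>y. x = y * y then 1 else -1)"
proof -
  have pow: "y ^ (2 * m) = 1" if "y \<noteq> 0" for y :: 'a
    using finite_field_power_card_eq_same[of y] that by (simp add: m)
  define S :: "'a set" where "S = {x. x \<noteq> 0 \<and> (\<exists>y. x = y * y)}"
  define p :: "'a poly" where "p = monom 1 m - 1"
  have m0: "m > 0"
  proof (rule ccontr)
    assume "\<not> m > 0"
    hence "CARD('a) = 1" using m by simp
    then obtain a :: 'a where "UNIV = {a}" by (metis card_1_singletonE)
    hence "(0 :: 'a) = 1" by (metis UNIV_I singletonD)
    thus False by simp
  qed
  have "coeff p m = 1" using m0 by (simp add: p_def)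
  hence p: "p \<noteq> 0" by auto
  have "degree p \<le> m"
    unfolding p_def by (intro degree_diff_le) (auto simp: degree_monom_le)
  hence roots: "card {x. poly p x = 0} \<le> m"
    using card_poly_roots_bound[OF p] by simp
  have "2 * m = card (UNIV - {0 :: 'a})" using m by simp
  also have "UNIV - {0 :: 'a} = (\<Union>s\<in>S. {y. y * y = s})"
    unfolding S_def by auto
  also have "card \<dots> \<le> (\<Sum>s\<in>S. card {y. y * y = s})"
    by (rule card_UN_le) simp
  also have "\<dots> \<le> (\<Sum>s\<in>S. 2)"
  proof (rule sum_mono)
    fix s assume "s \<in> S"
    then obtain z where z: "s = z * z" unfolding S_def by auto
    have "{y. y * y = s} \<subseteq> {z, -z}" using z by (auto simp: square_eq_iff)
    hence "card {y. y * y = s} \<le> card {z, -z}" by (intro card_mono) auto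
    also have "\<dots> \<le> 2" by (simp add: card_insert_if)
    finally show "card {y. y * y = s} \<le> 2" .
  qed
  finally have cS: "card S \<ge> m" by simp
  have sub: "S \<subseteq> {x. poly p x = 0}"
    using pow by (auto simp: S_def p_def poly_monom power_mult_distrib simp flip: power_add mult_2)
  show ?thesis
  proof (cases "\<exists>y. x = y * y")
    case True
    hence "x \<in> S" using assms by (auto simp: S_def)
    hence "poly p x = 0" using sub by auto
    thus ?thesis using True by (simp add: p_def poly_monom)
  next
    case False
    have "x ^ m \<noteq> 1"
    proof
      assume "x ^ m = 1"
      hence "insert x S \<subseteq> {x. poly p x = 0}" using sub by (auto simp: p_def poly_monom)
      hence "card (insert x S) \<le> m" using roots by (meson card_mono finite order.trans)
      moreover have "x \<notin> S" using False by (auto simp: S_def)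
      ultimately show False using cS by simp
    qed
    moreover have "x ^ m * x ^ m = 1" using pow[OF assms(2)] by (simp flip: power_add mult_2)
    hence "x ^ m = 1 \<or> x ^ m = -1" using square_eq_iff[of "x ^ m" 1] by simp
    ultimately show ?thesis using False by simp
  qed
qed

section \<open>Taylor expansion at an indeterminate centre\<close>

text \<open>
  The inner variable $Y$ is the centre and the outer one, $h$, the increment: this is $r(Y + h)$,
  and the coefficient of $h^i$ is the $i$-th Hasse derivative of $r$. The centre stays an
  indeterminate because a condition on these coefficients that holds identically in $Y$ can be
  counted by the degree in $Y$, however many points it is later evaluated at.
\<close>
definition taylor :: "'a::comm_ring_1 poly \<Rightarrow> 'a poly poly" where
  "taylor r = pcompose (map_poly (\<lambda>c. [:c:]) r) [:[:0, 1:], 1:]"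

text \<open>
  Substitution of $a$ for the inner variable $Y$.
\<close>
definition eval_coeffs :: "'a::comm_ring_1 \<Rightarrow> 'a poly poly \<Rightarrow> 'a poly" where
  "eval_coeffs a R = map_poly (\<lambda>p. poly p a) R"

definition coeff_degree_le :: "nat \<Rightarrow> 'a::comm_ring_1 poly poly \<Rightarrow> bool" where
  "coeff_degree_le B R \<longleftrightarrow> (\<forall>i. degree (coeff R i) \<le> B)"

lemma coeff_eval_coeffs [simp]: "coeff (eval_coeffs a R) i = poly (coeff R i) a"
  by (simp add: eval_coeffs_def coeff_map_poly)

lemma eval_coeffs_add: "eval_coeffs a (R + S) = eval_coeffs a R + eval_coeffs a S"
  by (rule poly_eqI) simp

lemma eval_coeffs_mult: "eval_coeffs a (R * S) = eval_coeffs a R * eval_coeffs a S"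
  by (rule poly_eqI) (simp add: coeff_mult poly_sum)

lemma eval_coeffs_const: "eval_coeffs a [:p:] = [:poly p a:]"
  by (rule poly_eqI) (simp add: coeff_pCons split: nat.splits)

lemma eval_coeffs_1: "eval_coeffs a 1 = 1"
  using eval_coeffs_const[of a 1] by (simp add: one_pCons)

lemma eval_coeffs_monom: "eval_coeffs a (monom 1 i) = monom 1 i"
  by (rule poly_eqI) (simp add: coeff_monom)

lemma eval_coeffs_power: "eval_coeffs a (R ^ n) = eval_coeffs a R ^ n"
  by (induction n) (simp_all add: eval_coeffs_1 eval_coeffs_mult)

lemma eval_coeffs_sum: "eval_coeffs a (\<Sum>i\<in>I. R i) = (\<Sum>i\<in>I. eval_coeffs a (R i))"
  by (rule poly_eqI) (simp add: coeff_sum poly_sum)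

lemmas eval_coeffs_hom =
  eval_coeffs_add eval_coeffs_mult eval_coeffs_const eval_coeffs_power eval_coeffs_sum
  eval_coeffs_monom

lemma taylor_0 [simp]: "taylor 0 = 0"
  by (simp add: taylor_def)

lemma taylor_pCons: "taylor (pCons c r) = [:[:c:]:] + [:[:0, 1:], 1:] * taylor r"
  by (simp add: taylor_def map_poly_pCons pcompose_pCons)

lemma taylor_diff: "taylor (r - s) = taylor r - taylor s"
proof -
  have "map_poly (\<lambda>c. [:c:]) (r - s) = map_poly (\<lambda>c. [:c:]) r - map_poly (\<lambda>c. [:c:]) s"
    by (rule poly_eqI) (simp add: coeff_map_poly)
  thus ?thesis by (simp add: taylor_def pcompose_diff)
qed

lemma eval_coeffs_taylor: "eval_coeffs a (taylor r) = pcompose r [:a, 1:]"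
proof (induction r)
  case 0
  show ?case by (simp add: eval_coeffs_def)
next
  case (pCons c r)
  have "eval_coeffs a [:[:0, 1:], 1:] = [:a, 1:]"
    by (rule poly_eqI) (simp add: coeff_pCons split: nat.splits)
  thus ?case
    unfolding taylor_pCons eval_coeffs_add eval_coeffs_mult eval_coeffs_const
      pcompose_pCons pCons.IH by simp
qed

lemma coeff_0_taylor: "coeff (taylor r) 0 = r"
proof (induction r)
  case (pCons c r)
  show ?case by (simp add: taylor_pCons pCons.IH)
qed simp

lemma coeff_degree_le_mono: "coeff_degree_le B R \<Longrightarrow> B \<le> C \<Longrightarrow> coeff_degree_le C R"
  unfolding coeff_degree_le_def by (meson order.trans)

lemma coeff_degree_le_add:
  "coeff_degree_le B R \<Longrightarrow> coeff_degree_le B S \<Longrightarrow> coeff_degree_le B (R + S)"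
  unfolding coeff_degree_le_def by (simp add: degree_add_le)

lemma coeff_degree_le_sum:
  "(\<And>i. i \<in> I \<Longrightarrow> coeff_degree_le B (R i)) \<Longrightarrow> coeff_degree_le B (\<Sum>i\<in>I. R i)"
  unfolding coeff_degree_le_def coeff_sum
  by (induction I rule: infinite_finite_induct) (auto intro: degree_add_le)

lemma coeff_degree_le_mult:
  assumes "coeff_degree_le B R" "coeff_degree_le C S"
  shows "coeff_degree_le (B + C) (R * S)"
  unfolding coeff_degree_le_def coeff_mult
proof
  fix n
  show "degree (\<Sum>i\<le>n. coeff R i * coeff S (n - i)) \<le> B + C"
  proof (intro degree_sum_le)
    fix i assume "i \<in> {..n}"
    show "degree (coeff R i * coeff S (n - i)) \<le> B + C"
      by (rule order.trans[OF degree_mult_le])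
         (use assms in \<open>auto simp: coeff_degree_le_def intro!: add_mono\<close>)
  qed simp
qed

lemma coeff_degree_le_const: "degree p \<le> B \<Longrightarrow> coeff_degree_le B [:p:]"
  unfolding coeff_degree_le_def by (simp add: coeff_pCons split: nat.splits)

lemma coeff_degree_le_monom: "coeff_degree_le 0 (monom 1 i)"
  unfolding coeff_degree_le_def by (simp add: coeff_monom)

lemma coeff_degree_le_power: "coeff_degree_le B R \<Longrightarrow> coeff_degree_le (n * B) (R ^ n)"
proof (induction n)
  case 0
  show ?case using coeff_degree_le_const[of 1 0] by (simp add: one_pCons)
next
  case (Suc n)
  thus ?case using coeff_degree_le_mult[of B R "n * B" "R ^ n"] by simp
qed

lemma coeff_degree_le_taylor: "coeff_degree_le (degree r) (taylor r)"
proof (induction r)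
  case 0
  show ?case by (simp add: coeff_degree_le_def)
next
  case (pCons c r)
  show ?case
  proof (cases "r = 0")
    case True
    thus ?thesis by (simp add: taylor_pCons coeff_degree_le_const)
  next
    case False
    have "coeff_degree_le 1 [:[:0, 1:], 1:]"
      unfolding coeff_degree_le_def by (simp add: coeff_pCons split: nat.splits)
    from coeff_degree_le_mult[OF this pCons.IH] False show ?thesis
      by (auto simp: taylor_pCons intro!: coeff_degree_le_add coeff_degree_le_const)
  qed
qed

text \<open>
  The condition on the coefficients stands for $\deg p < n$, but is also right for $n = 0$.
\<close>
lemma card_polys_coeff_eq_0:
  "finite {p :: 'a::{finite,comm_ring_1} poly. \<forall>i\<ge>n. coeff p i = 0}"
  "card {p :: 'a::{finite,comm_ring_1} poly. \<forall>i\<ge>n. coeff p i = 0} = CARD('a) ^ n"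
proof -
  let ?P = "{p :: 'a poly. \<forall>i\<ge>n. coeff p i = 0}"
  let ?g = "\<lambda>g :: nat \<Rightarrow> 'a. \<Sum>i<n. monom (g i) i"
  have coeff_g: "coeff (?g g) i = (if i < n then g i else 0)" for g i
    by (simp add: coeff_sum)
  have "bij_betw (\<lambda>p. restrict (coeff p) {..<n}) ?P ({..<n} \<rightarrow>\<^sub>E UNIV)"
  proof (rule bij_betw_byWitness[where f' = ?g])
    show "\<forall>p\<in>?P. ?g (restrict (coeff p) {..<n}) = p"
      by (intro ballI poly_eqI) (simp add: coeff_g)
    show "\<forall>g\<in>{..<n} \<rightarrow>\<^sub>E UNIV. restrict (coeff (?g g)) {..<n} = g"
    proof (intro ballI ext)
      fix g :: "nat \<Rightarrow> 'a" and i assume "g \<in> {..<n} \<rightarrow>\<^sub>E UNIV"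
      from PiE_arb[OF this, of i] show "restrict (coeff (?g g)) {..<n} i = g i"
        by (simp add: coeff_g)
    qed
    show "(\<lambda>p. restrict (coeff p) {..<n}) ` ?P \<subseteq> {..<n} \<rightarrow>\<^sub>E UNIV"
      by (intro image_subsetI restrict_PiE[THEN iffD2]) simp
    show "?g ` ({..<n} \<rightarrow>\<^sub>E UNIV) \<subseteq> ?P"
      by (intro image_subsetI) (simp add: coeff_g)
  qed
  from bij_betw_finite[OF this] bij_betw_same_card[OF this]
  show "finite ?P" "card ?P = CARD('a) ^ n"
    by (simp_all add: finite_PiE card_PiE)
qed

lemma pcompose_power: "pcompose (p ^ n) q = pcompose p q ^ n"
  by (induction n) (simp_all add: pcompose_mult pcompose_1)

lemma monom_dvd_iff_coeff:
  "monom (1::'a::field) n dvd p \<longleftrightarrow> (\<forall>i<n. coeff p i = 0)"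
proof
  assume "monom 1 n dvd p"
  then obtain r where "p = monom 1 n * r" by (elim dvdE)
  thus "\<forall>i<n. coeff p i = 0" by (simp add: coeff_monom_mult)
next
  assume *: "\<forall>i<n. coeff p i = 0"
  have "p = monom 1 n * poly_shift n p"
    by (rule poly_eqI) (use * in \<open>auto simp: coeff_monom_mult coeff_poly_shift not_less\<close>)
  thus "monom 1 n dvd p" by (rule dvdI)
qed

section \<open>The method of Stepanov\<close>

text \<open>
  Modulo $(X - a)^l$ with $l \le q$, the factor $X^{qj} = (a + (X - a)^q)^j$ is the constant $a^j$.
  So these factors raise the degree, and with it the number of free coefficients, at almost no
  cost in the conditions for a zero of order $l$ at $a$.
\<close>
definition auxiliary_poly ::
  "nat \<Rightarrow> nat \<Rightarrow> 'a::finite_field poly \<Rightarrow> (nat \<Rightarrow> 'a poly) \<Rightarrow> (nat \<Rightarrow> 'a poly) \<Rightarrow> 'a poly" where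
  "auxiliary_poly J m f r s =
     (\<Sum>j<J. (r j + s j * f ^ m) * monom 1 (CARD('a) * j))"

text \<open>
  With $f(Y + h) = f(Y) + h v$, the binomial series of $(f + h v)^m$ is broken off before $h^l$ and
  multiplied by $f^{l - 1 - m}$. Multiplying by $f^{l-1}$ clears the denominators of
  $(1 + h v / f)^m$, and dividing by $f^m$ removes the large power, which is the constant $c$ at
  the points of interest. What remains has degree about $d l$ in $Y$ instead of $d m$.
\<close>
definition power_truncation :: "nat \<Rightarrow> nat \<Rightarrow> 'a::comm_ring_1 poly \<Rightarrow> 'a poly poly" where
  "power_truncation m l f =
     (\<Sum>i<l. [:of_nat (m choose i) * f ^ (l - 1 - i):] * monom 1 i *
       poly_shift 1 (taylor f) ^ i)"

text \<open>
  This is $f(a)^{l-1}$ times the expansion of the auxiliary polynomial at $a$, modulo $h^l$, in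
  which $f(a)^m$ has been replaced by $c$ and $a$ by the indeterminate $Y$.
\<close>
definition vanishing_conditions ::
  "nat \<Rightarrow> nat \<Rightarrow> nat \<Rightarrow> 'a::comm_ring_1 \<Rightarrow> 'a poly \<Rightarrow> (nat \<Rightarrow> 'a poly) \<Rightarrow> (nat \<Rightarrow> 'a poly) \<Rightarrow> 'a poly poly" where
  "vanishing_conditions J m l c f r s =
     (\<Sum>j<J. [:monom 1 j:] *
        ([:f ^ (l - 1):] * taylor (r j) + [:[:c:]:] * (power_truncation m l f * taylor (s j))))"

lemma vanishing_conditions_diff:
  "vanishing_conditions J m l c f (\<lambda>j. r j - r' j) (\<lambda>j. s j - s' j) =
   vanishing_conditions J m l c f r s - vanishing_conditions J m l c f r' s'"
  unfolding vanishing_conditions_def taylor_diff sum_subtractf[symmetric]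
  by (rule sum.cong) (simp_all only: algebra_simps)

lemma power_truncation_cong:
  fixes f :: "'a::field poly"
  assumes "0 < l" "l \<le> Suc m"
  shows "[[:poly f a:] ^ (l - 1) * pcompose f [:a, 1:] ^ m =
    [:poly f a ^ m:] * eval_coeffs a (power_truncation m l f)] (mod monom 1 l)"
proof -
  define X where "X = (monom 1 1 :: 'a poly)"
  define v where "v = eval_coeffs a (poly_shift 1 (taylor f))"
  define y where "y = [:poly f a:]"
  have "eval_coeffs a (taylor f) = y + X * v"
    by (rule poly_eqI)
       (auto simp: y_def X_def v_def coeff_monom_mult coeff_poly_shift coeff_0_taylor
         coeff_pCons split: nat.splits)
  hence sh: "pcompose f [:a, 1:] = X * v + y"
    by (simp add: eval_coeffs_taylor add.commute)
  have Xl: "monom 1 i = X ^ i" for i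
    by (simp add: X_def monom_power)
  have "y ^ (l - 1) * (X * v + y) ^ m =
      (\<Sum>i\<le>m. of_nat (m choose i) * (X * v) ^ i * y ^ (m - i) * y ^ (l - 1))"
    by (simp add: binomial_ring sum_distrib_left mult_ac)
  also have "[\<dots> = (\<Sum>i<l. of_nat (m choose i) * (X * v) ^ i * y ^ (m - i) * y ^ (l - 1))] (mod X ^ l)"
  proof -
    have "(\<Sum>i\<le>m. of_nat (m choose i) * (X * v) ^ i * y ^ (m - i) * y ^ (l - 1)) =
      (\<Sum>i<l. of_nat (m choose i) * (X * v) ^ i * y ^ (m - i) * y ^ (l - 1)) +
      (\<Sum>i\<in>{l..m}. of_nat (m choose i) * (X * v) ^ i * y ^ (m - i) * y ^ (l - 1))"
      using assms by (subst sum.union_disjoint[symmetric]) (auto intro!: sum.cong)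
    moreover have "X ^ l dvd (\<Sum>i\<in>{l..m}. of_nat (m choose i) * (X * v) ^ i * y ^ (m - i) * y ^ (l - 1))"
    proof (rule dvd_sum)
      fix i assume "i \<in> {l..m}"
      hence "X ^ l dvd X ^ i" by (simp add: le_imp_power_dvd)
      hence "X ^ l dvd (X * v) ^ i" by (simp add: power_mult_distrib)
      thus "X ^ l dvd of_nat (m choose i) * (X * v) ^ i * y ^ (m - i) * y ^ (l - 1)"
        by (auto intro: dvd_mult2 dvd_mult)
    qed
    ultimately show ?thesis by (simp add: cong_iff_dvd_diff)
  qed
  also have "(\<Sum>i<l. of_nat (m choose i) * (X * v) ^ i * y ^ (m - i) * y ^ (l - 1)) =
      y ^ m * (\<Sum>i<l. of_nat (m choose i) * y ^ (l - 1 - i) * X ^ i * v ^ i)"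
    unfolding sum_distrib_left
  proof (rule sum.cong)
    fix i assume "i \<in> {..<l}"
    hence e: "(m - i) + (l - 1) = m + (l - 1 - i)" using assms by auto
    have "y ^ (m - i) * y ^ (l - 1) = y ^ m * y ^ (l - 1 - i)"
      unfolding power_add[symmetric] e ..
    thus "of_nat (m choose i) * (X * v) ^ i * y ^ (m - i) * y ^ (l - 1) =
        y ^ m * (of_nat (m choose i) * y ^ (l - 1 - i) * X ^ i * v ^ i)"
      by (simp add: power_mult_distrib mult_ac)
  qed simp
  also have "(\<Sum>i<l. of_nat (m choose i) * y ^ (l - 1 - i) * X ^ i * v ^ i) =
      eval_coeffs a (power_truncation m l f)"
    unfolding power_truncation_def eval_coeffs_hom v_def[symmetric] Xl
    by (rule sum.cong) (simp_all add: y_def poly_const_pow of_nat_poly mult_ac)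
  finally show ?thesis
    unfolding sh Xl y_def[symmetric] by (simp add: y_def poly_const_pow)
qed

text \<open>
  At a point with $f(a)^m = c$ the expansion of the auxiliary polynomial and the polynomial of
  conditions agree modulo $h^l$ up to the nonzero factor $f(a)^{l-1}$, so the vanishing of the
  first $l$ conditions is a zero of order $l$.
\<close>
lemma auxiliary_poly_vanishes:
  fixes f :: "'a::finite_field poly"
  assumes l: "0 < l" "l \<le> Suc m" "l \<le> CARD('a)"
    and a: "poly f a \<noteq> 0" "poly f a ^ m = c"
    and van: "\<And>i. i < l \<Longrightarrow> coeff (vanishing_conditions J m l c f r s) i = 0"
  shows "[:-a, 1:] ^ l dvd auxiliary_poly J m f r s"
proof -
  define q where "q = CARD('a)"
  define X where "X = (monom 1 1 :: 'a poly)"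
  have Xl: "monom 1 i = X ^ i" for i
    by (simp add: X_def monom_power)
  define sh where "sh = (\<lambda>u :: 'a poly. pcompose u [:a, 1:])"
  define y where "y = [:poly f a:]"
  define W where "W = eval_coeffs a (power_truncation m l f)"
  define P where "P = auxiliary_poly J m f r s"
  have frob: "[[:a, 1:] ^ q = [:a:]] (mod X ^ l)"
  proof -
    have "[:a, 1:] ^ q = ([:a:] + X) ^ q"
      by (simp add: X_def monom_altdef)
    also have "\<dots> = [:a:] + X ^ q"
      unfolding q_def poly_power_card_add
      by (simp add: poly_const_pow finite_field_power_card_eq_same)
    finally have "[:a, 1:] ^ q = [:a:] + X ^ q" .
    thus ?thesis using l(3) by (simp add: cong_iff_dvd_diff le_imp_power_dvd q_def)
  qed
  have sh_X: "sh X = [:a, 1:]"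
    by (simp add: sh_def X_def monom_altdef pcompose_pCons)
  have trunc: "[y ^ (l - 1) * sh f ^ m = [:c:] * W] (mod X ^ l)"
    using power_truncation_cong[OF l(1,2), of f a] by (simp only: a(2) Xl sh_def y_def W_def)
  have shP: "sh P = (\<Sum>j<J. (sh (r j) + sh (s j) * sh f ^ m) * ([:a, 1:] ^ q) ^ j)"
    unfolding P_def auxiliary_poly_def sh_def pcompose_sum pcompose_mult pcompose_add
      pcompose_power Xl power_mult q_def[symmetric] sh_X[unfolded sh_def] ..
  have "y ^ (l - 1) * sh P =
      (\<Sum>j<J. (y ^ (l - 1) * sh (r j) + sh (s j) * (y ^ (l - 1) * sh f ^ m)) * ([:a, 1:] ^ q) ^ j)"
    unfolding shP sum_distrib_left by (rule sum.cong) (simp_all add: algebra_simps)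
  also have "[\<dots> = (\<Sum>j<J. (y ^ (l - 1) * sh (r j) + sh (s j) * ([:c:] * W)) * [:a:] ^ j)]
      (mod X ^ l)"
    by (intro cong_sum cong_mult[OF cong_add cong_pow] cong_mult[OF cong_refl] trunc frob cong_refl)
  also have "(\<Sum>j<J. (y ^ (l - 1) * sh (r j) + sh (s j) * ([:c:] * W)) * [:a:] ^ j) =
      eval_coeffs a (vanishing_conditions J m l c f r s)"
    unfolding vanishing_conditions_def eval_coeffs_hom eval_coeffs_taylor sh_def[symmetric] W_def[symmetric]
    by (rule sum.cong) (simp_all add: y_def sh_def poly_const_pow poly_monom mult_ac)
  also have "[\<dots> = 0] (mod X ^ l)"
    unfolding cong_0_iff Xl[symmetric] monom_dvd_iff_coeff using van by simp
  finally have "X ^ l dvd y ^ (l - 1) * sh P"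
    by (simp add: cong_0_iff)
  hence "X ^ l dvd smult (poly f a ^ (l - 1)) (sh P)"
    by (simp add: y_def poly_const_pow)
  hence "X ^ l dvd sh P"
    using a(1) by (simp add: dvd_smult_iff)
  then obtain T where "sh P = X ^ l * T" by (elim dvdE)
  hence "pcompose (sh P) [:-a, 1:] = pcompose X [:-a, 1:] ^ l * pcompose T [:-a, 1:]"
    by (simp add: pcompose_mult pcompose_power)
  moreover have "pcompose X [:-a, 1:] = [:-a, 1:]"
    by (simp add: X_def monom_altdef pcompose_pCons)
  moreover have "pcompose (sh P) [:-a, 1:] = P"
    unfolding sh_def pcompose_assoc[symmetric] by (simp add: pcompose_pCons)
  ultimately show ?thesis unfolding P_def by (metis dvd_triv_left)
qed

text \<open>
  This is the only place where $f$ must not be a square. If the sum vanished, its first nonzero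
  summand $r + s f^m$ would be divisible by $X^q$. Multiplying by $f (r - s f^m)$ gives
  $f r^2 \equiv s^2 f^q \pmod{X^q}$, and $f^q \equiv f(0)^q = 1$, so $f r^2 \equiv s^2$. Both sides
  have degree below $q$, hence they are equal.
\<close>
lemma auxiliary_poly_nonzero:
  fixes f :: "'a::finite_field poly"
  assumes m: "CARD('a) = 2 * m + 1" and f0: "poly f 0 = 1"
    and nonsq: "\<And>r s. f * r\<^sup>2 = s\<^sup>2 \<Longrightarrow> r = 0"
    and D: "degree f + 2 * D < CARD('a) + 2"
    and deg: "\<And>j i. j < J \<Longrightarrow> i \<ge> D \<Longrightarrow> coeff (r j) i = 0"
      "\<And>j i. j < J \<Longrightarrow> i \<ge> D \<Longrightarrow> coeff (s j) i = 0"
    and nz: "\<exists>j<J. r j \<noteq> 0 \<or> s j \<noteq> 0"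
  shows "auxiliary_poly J m f r s \<noteq> 0"
proof
  define q where "q = CARD('a)"
  define X where "X = (monom 1 1 :: 'a poly)"
  have Xl: "monom 1 i = X ^ i" for i
    by (simp add: X_def monom_power)
  have X0: "X \<noteq> 0" by (simp add: X_def)
  assume "auxiliary_poly J m f r s = 0"
  define t where "t = (\<lambda>j. r j + s j * f ^ m)"
  hence sum0: "(\<Sum>j<J. t j * (X ^ q) ^ j) = 0"
    using \<open>auxiliary_poly J m f r s = 0\<close>
    by (simp add: auxiliary_poly_def Xl power_mult q_def)
  define k where "k = (LEAST j. j < J \<and> (r j \<noteq> 0 \<or> s j \<noteq> 0))"
  have k: "k < J" "r k \<noteq> 0 \<or> s k \<noteq> 0"
    using LeastI_ex[OF nz] unfolding k_def by auto
  have before: "t j = 0" if "j < k" for j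
    using not_less_Least[of j "\<lambda>j. j < J \<and> (r j \<noteq> 0 \<or> s j \<noteq> 0)"] that k(1)
    by (auto simp: k_def t_def)
  have "(\<Sum>j<J. t j * (X ^ q) ^ j) = (\<Sum>j\<in>{k} \<union> {k<..<J}. t j * (X ^ q) ^ j)"
    by (rule sum.mono_neutral_right) (use k before in \<open>auto simp: not_less\<close>)
  also have "\<dots> = t k * (X ^ q) ^ k + (\<Sum>j\<in>{k<..<J}. t j * (X ^ q) ^ j)"
    by simp
  finally have "t k * (X ^ q) ^ k = - (\<Sum>j\<in>{k<..<J}. t j * (X ^ q) ^ j)"
    using sum0 by (simp add: eq_neg_iff_add_eq_0)
  moreover have "(X ^ q) ^ Suc k dvd (\<Sum>j\<in>{k<..<J}. t j * (X ^ q) ^ j)"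
    by (intro dvd_sum dvd_mult le_imp_power_dvd) auto
  ultimately have "(X ^ q) ^ Suc k dvd t k * (X ^ q) ^ k" by simp
  hence "X ^ q * (X ^ q) ^ k dvd t k * (X ^ q) ^ k" by simp
  hence tk: "X ^ q dvd t k"
    using X0 by (metis dvd_mult_cancel_right power_not_zero)
  have "X dvd f - 1"
    using monom_dvd_iff_coeff[of 1 "f - 1"] f0 by (simp add: X_def poly_0_coeff_0)
  then obtain g where "f - 1 = X * g" by (elim dvdE)
  hence "f = 1 + X * g" by (simp add: algebra_simps)
  hence "f ^ q = 1 + X ^ q * g ^ q"
    by (simp add: q_def poly_power_card_add power_mult_distrib)
  hence fq: "X ^ q dvd f ^ q - 1" by simp
  have "f * (r k)\<^sup>2 - (s k)\<^sup>2 = f * (r k - s k * f ^ m) * t k + (s k)\<^sup>2 * (f ^ q - 1)"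
  proof -
    have "f ^ q = f * f ^ m * f ^ m" unfolding q_def m by (simp add: power_add mult_2)
    thus ?thesis unfolding t_def by (simp add: algebra_simps power2_eq_square)
  qed
  also have "X ^ q dvd \<dots>"
    by (intro dvd_add dvd_mult tk fq)
  finally have div: "X ^ q dvd f * (r k)\<^sup>2 - (s k)\<^sup>2" .
  have D0: "D > 0"
  proof (rule ccontr)
    assume "\<not> D > 0"
    hence "r k = 0" "s k = 0" using deg[OF k(1)] by (auto intro!: poly_eqI)
    thus False using k by auto
  qed
  have dr: "degree (r k) \<le> D - 1" "degree (s k) \<le> D - 1"
    using deg[OF k(1)] D0 by (auto intro!: degree_le)
  have "coeff (f * (r k)\<^sup>2 - (s k)\<^sup>2) i = 0" if "i \<ge> q" for i
  proof -
    have "degree (f * (r k)\<^sup>2) \<le> degree f + 2 * (D - 1)"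
      using degree_mult_le[of f "(r k)\<^sup>2"] degree_power_le[of "r k" 2] dr by linarith
    moreover have "degree ((s k)\<^sup>2) \<le> 2 * (D - 1)"
      using degree_power_le[of "s k" 2] dr by linarith
    moreover have "degree f + 2 * (D - 1) < q" using D D0 by (simp add: q_def)
    ultimately show ?thesis using that by (simp add: coeff_eq_0)
  qed
  moreover have "coeff (f * (r k)\<^sup>2 - (s k)\<^sup>2) i = 0" if "i < q" for i
    using div that unfolding Xl[symmetric] monom_dvd_iff_coeff by blast
  ultimately have "f * (r k)\<^sup>2 - (s k)\<^sup>2 = 0"
    by (intro poly_eqI) (metis coeff_0 not_less)
  hence eq: "f * (r k)\<^sup>2 = (s k)\<^sup>2" by simp
  hence "r k = 0" by (rule nonsq)
  moreover from this eq have "s k = 0" by simp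
  ultimately show False using k by auto
qed

lemma card_mult_le_degree_of_vanishing:
  fixes P :: "'a::field poly"
  assumes "P \<noteq> 0" and "\<And>a. a \<in> A \<Longrightarrow> [:-a, 1:] ^ l dvd P"
  shows "l * card A \<le> degree P"
proof (cases "l = 0")
  case False
  have "A \<subseteq> {x. poly P x = 0}"
  proof
    fix a assume "a \<in> A"
    hence "[:-a, 1:] ^ 1 dvd P"
      using assms(2) False by (meson power_le_dvd less_one not_less)
    thus "a \<in> {x. poly P x = 0}" by (simp add: poly_eq_0_iff_dvd)
  qed
  hence "(\<Sum>a\<in>A. order a P) \<le> (\<Sum>x | poly P x = 0. order x P)"
    by (intro sum_mono2 poly_roots_finite assms(1)) auto
  moreover have "(\<Sum>a\<in>A. l) \<le> (\<Sum>a\<in>A. order a P)"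
    using assms by (intro sum_mono) (simp add: order_divides)
  ultimately have "(\<Sum>a\<in>A. l) \<le> (\<Sum>x | poly P x = 0. order x P)" by simp
  also have "\<dots> \<le> degree P" by (rule sum_order_le_degree) fact
  finally show ?thesis by (simp add: mult.commute)
qed simp

lemma coeff_degree_le_power_truncation:
  "degree f \<le> d \<Longrightarrow> coeff_degree_le (d * (l - 1)) (power_truncation m l f)"
  unfolding power_truncation_def
proof (rule coeff_degree_le_sum)
  fix i assume d: "degree f \<le> d" and "i \<in> {..<l}"
  hence e: "(l - 1 - i) * d + 0 + i * d = d * (l - 1)"
    by (simp flip: add_mult_distrib)
  have "degree (f ^ (l - 1 - i)) \<le> (l - 1 - i) * d"
    unfolding mult.commute[of _ d] by (rule order.trans[OF degree_power_le mult_le_mono1[OF d]])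
  hence c: "coeff_degree_le ((l - 1 - i) * d) [:of_nat (m choose i) * f ^ (l - 1 - i):]"
    using degree_mult_le[of "of_nat (m choose i)" "f ^ (l - 1 - i)"]
    by (intro coeff_degree_le_const) simp
  have "coeff_degree_le d (poly_shift 1 (taylor f))"
    using coeff_degree_le_mono[OF coeff_degree_le_taylor d]
    by (simp add: coeff_degree_le_def coeff_poly_shift)
  from coeff_degree_le_mult[OF coeff_degree_le_mult[OF c coeff_degree_le_monom[of i]]
      coeff_degree_le_power[OF this, of i]]
  show "coeff_degree_le (d * (l - 1)) ([:of_nat (m choose i) * f ^ (l - 1 - i):] *
      monom 1 i * poly_shift 1 (taylor f) ^ i)"
    unfolding e .
qed

lemma coeff_degree_le_vanishing_conditions:
  assumes f: "degree f \<le> d" and r: "\<And>j. j < J \<Longrightarrow> degree (r j) \<le> E"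
    and s: "\<And>j. j < J \<Longrightarrow> degree (s j) \<le> E"
  shows "coeff_degree_le (J - 1 + d * (l - 1) + E) (vanishing_conditions J m l c f r s)"
  unfolding vanishing_conditions_def
proof (rule coeff_degree_le_sum)
  fix j assume j: "j \<in> {..<J}"
  have "degree (f ^ (l - 1)) \<le> d * (l - 1)"
    by (rule order.trans[OF degree_power_le mult_le_mono1[OF f]])
  hence "coeff_degree_le (d * (l - 1) + E) ([:f ^ (l - 1):] * taylor (r j))"
    using j r by (intro coeff_degree_le_mult coeff_degree_le_const
        coeff_degree_le_mono[OF coeff_degree_le_taylor]) auto
  moreover have "coeff_degree_le (0 + (d * (l - 1) + E))
      ([:[:c:]:] * (power_truncation m l f * taylor (s j)))"
    using j s by (intro coeff_degree_le_mult coeff_degree_le_const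
        coeff_degree_le_power_truncation f coeff_degree_le_mono[OF coeff_degree_le_taylor]) auto
  ultimately have "coeff_degree_le (d * (l - 1) + E)
      ([:f ^ (l - 1):] * taylor (r j) + [:[:c:]:] * (power_truncation m l f * taylor (s j)))"
    by (intro coeff_degree_le_add) simp_all
  moreover have "coeff_degree_le (J - 1) [:monom 1 j:]"
    using j by (intro coeff_degree_le_const order.trans[OF degree_monom_le]) auto
  ultimately show "coeff_degree_le (J - 1 + d * (l - 1) + E) ([:monom 1 j:] *
      ([:f ^ (l - 1):] * taylor (r j) + [:[:c:]:] * (power_truncation m l f * taylor (s j))))"
    unfolding add.assoc by (intro coeff_degree_le_mult)
qed

text \<open>
  The conditions are additive in $(r, s)$ and there are fewer of them than free coefficients, so by
  the pigeonhole principle two different pairs yield the same coefficients; their difference is a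
  nontrivial solution.
\<close>
lemma vanishing_conditions_solvable:
  fixes f :: "'a::finite_field poly"
  assumes f: "degree f \<le> d" and D: "D > 0"
    and count: "l * (J + d * (l - 1) + D) < 2 * J * D"
  shows "\<exists>r s. (\<forall>j<J. \<forall>i\<ge>D. coeff (r j) i = 0 \<and> coeff (s j) i = 0) \<and>
    (\<exists>j<J. r j \<noteq> 0 \<or> s j \<noteq> 0) \<and>
    (\<forall>i<l. coeff (vanishing_conditions J m l c f r s) i = 0)"
proof -
  define pols where "pols = (\<lambda>n. {p :: 'a poly. \<forall>i\<ge>n. coeff p i = 0})"
  define B where "B = J + d * (l - 1) + D"
  define S where "S = ({..<J} \<rightarrow>\<^sub>E pols D) \<times> ({..<J} \<rightarrow>\<^sub>E pols D)"
  define T where "T = ({..<l} \<rightarrow>\<^sub>E pols B)"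
  define \<Phi> where "\<Phi> = (\<lambda>(r, s). restrict (coeff (vanishing_conditions J m l c f r s)) {..<l})"
  have fin: "finite (pols n)" and card: "card (pols n) = CARD('a) ^ n" for n
    unfolding pols_def by (rule card_polys_coeff_eq_0)+
  have degD: "degree p \<le> D - 1" if "p \<in> pols D" for p
    using that D by (intro degree_le) (auto simp: pols_def)
  have "\<Phi> ` S \<subseteq> T"
  proof
    fix t assume "t \<in> \<Phi> ` S"
    then obtain r s where t: "t = \<Phi> (r, s)" and rs: "(r, s) \<in> S" by auto
    have "coeff_degree_le (J - 1 + d * (l - 1) + (D - 1)) (vanishing_conditions J m l c f r s)"
      using rs by (intro coeff_degree_le_vanishing_conditions f degD) (auto simp: S_def)
    hence le: "degree (coeff (vanishing_conditions J m l c f r s) i) \<le>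
        J - 1 + d * (l - 1) + (D - 1)" for i
      by (simp add: coeff_degree_le_def)
    have "degree (coeff (vanishing_conditions J m l c f r s) i) < B" for i
      using le[of i] D unfolding B_def by linarith
    hence "coeff (vanishing_conditions J m l c f r s) i \<in> pols B" for i
      by (auto simp: pols_def intro!: coeff_eq_0 intro: order.strict_trans2)
    thus "t \<in> T" unfolding t \<Phi>_def T_def by auto
  qed
  moreover have "finite T" unfolding T_def by (intro finite_PiE fin) auto
  ultimately have "card (\<Phi> ` S) \<le> card T" by (intro card_mono)
  also have "card T = CARD('a) ^ (l * B)"
    unfolding T_def by (simp add: card_PiE card mult.commute flip: power_mult)
  also have "\<dots> < CARD('a) ^ (2 * J * D)"
  proof (rule power_strict_increasing)
    show "1 < CARD('a)"
      using card_mono[of UNIV "{0, 1 :: 'a}"] by simp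
  qed (use count in \<open>simp add: B_def\<close>)
  also have "CARD('a) ^ (2 * J * D) = card S"
    unfolding S_def by (simp add: card_cartesian_product card_PiE card mult_ac
        flip: power_mult power_add mult_2)
  finally have "\<not> inj_on \<Phi> S" by (metis less_irrefl card_image)
  then obtain r s r' s' where in_S: "(r, s) \<in> S" "(r', s') \<in> S"
    and ne: "(r, s) \<noteq> (r', s')" and eq: "\<Phi> (r, s) = \<Phi> (r', s')"
    unfolding inj_on_def by fastforce
  show ?thesis
  proof (rule exI[of _ "\<lambda>j. r j - r' j"], rule exI[of _ "\<lambda>j. s j - s' j"],
      intro conjI allI impI)
    fix j i assume "j < J" "i \<ge> D"
    thus "coeff (r j - r' j) i = 0" "coeff (s j - s' j) i = 0"
      using in_S by (auto simp: S_def pols_def PiE_iff)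
  next
    have "\<exists>j<J. r j \<noteq> r' j \<or> s j \<noteq> s' j"
    proof (rule ccontr)
      assume "\<not> ?thesis"
      hence *: "r j = r' j" "s j = s' j" if "j < J" for j using that by blast+
      have "r = r'" by (rule PiE_ext[of _ "{..<J}" "\<lambda>_. pols D"]) (use in_S * in \<open>auto simp: S_def\<close>)
      moreover have "s = s'" by (rule PiE_ext[of _ "{..<J}" "\<lambda>_. pols D"]) (use in_S * in \<open>auto simp: S_def\<close>)
      ultimately show False using ne by simp
    qed
    thus "\<exists>j<J. r j - r' j \<noteq> 0 \<or> s j - s' j \<noteq> 0" by simp
  next
    fix i assume "i < l"
    hence "coeff (vanishing_conditions J m l c f r s) i = coeff (vanishing_conditions J m l c f r' s') i"
      using fun_cong[OF eq, of i] unfolding \<Phi>_def by simp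
    thus "coeff (vanishing_conditions J m l c f (\<lambda>j. r j - r' j) (\<lambda>j. s j - s' j)) i = 0"
      unfolding vanishing_conditions_diff by simp
  qed
qed

text \<open>
  The $2 J D$ coefficients with $D \approx q / 2$ have to meet about $l D$ conditions, so that
  $l = 2 J - 1$ is affordable as soon as $q$ is large. The auxiliary polynomial then has degree at
  most $(J + d) q$ and a zero of order $l$ at every point that is counted, which makes the
  proportion of these points at most $(J + d) / (2 J - 1)$. It tends to $1 / 2$ as $J$ grows.
\<close>
theorem stepanov_bound:
  fixes f :: "'a::finite_field poly"
  assumes m: "CARD('a) = 2 * m + 1" and f0: "poly f 0 = 1" and d: "degree f \<le> d"
    and nonsq: "\<And>r s. f * r\<^sup>2 = s\<^sup>2 \<Longrightarrow> r = 0"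
    and J: "J > 0" and large: "CARD('a) \<ge> d + 3 + 4 * J\<^sup>2 * (2 * d + 1)"
  shows "(2 * J - 1) * card {a. poly f a \<noteq> 0 \<and> poly f a ^ m = c} \<le> (J + d) * CARD('a)"
proof -
  define q where "q = CARD('a)"
  define l where "l = 2 * J - 1"
  define D where "D = (q - d) div 2"
  have lJ: "l + 1 = 2 * J" "0 < l" using J by (auto simp: l_def)
  have D_low: "q \<le> 2 * D + d + 1" and D_up: "2 * D + d \<le> q"
    using large by (auto simp: D_def q_def)
  have D_big: "D > 2 * J\<^sup>2 * (2 * d + 1)" using D_low large by (simp add: q_def)
  \<comment> \<open>The main terms \<open>l * D\<close> and \<open>2 * J * D\<close> differ by \<open>D\<close>, which has to exceed all lower-order terms.\<close>
  have "l * (J + d * (l - 1)) \<le> (2 * J) * (J + d * (2 * J))"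
    by (intro mult_mono add_mono) (auto simp: l_def)
  also have "\<dots> = 2 * J\<^sup>2 * (2 * d + 1)"
    by (simp add: algebra_simps power2_eq_square)
  finally have "l * (J + d * (l - 1)) < D" using D_big by linarith
  moreover have "2 * J * D = l * D + D" unfolding lJ(1)[symmetric] by simp
  ultimately have count: "l * (J + d * (l - 1) + D) < 2 * J * D"
    by (simp add: add_mult_distrib2)
  have D0: "D > 0" using D_big by simp
  from vanishing_conditions_solvable[OF d D0 count, of m c] obtain r s where
    deg: "\<And>j i. j < J \<Longrightarrow> i \<ge> D \<Longrightarrow> coeff (r j) i = 0"
      "\<And>j i. j < J \<Longrightarrow> i \<ge> D \<Longrightarrow> coeff (s j) i = 0"
    and nz: "\<exists>j<J. r j \<noteq> 0 \<or> s j \<noteq> 0"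
    and van: "\<And>i. i < l \<Longrightarrow> coeff (vanishing_conditions J m l c f r s) i = 0"
    by blast
  define P where "P = auxiliary_poly J m f r s"
  have P0: "P \<noteq> 0"
    unfolding P_def by (rule auxiliary_poly_nonzero[OF m f0 nonsq _ deg nz])
      (use D_up d in \<open>auto simp: q_def\<close>)
  \<comment> \<open>The truncation of the binomial series needs \<open>l \<le> m + 1\<close>.\<close>
  have "J \<le> J\<^sup>2" using J by (simp add: power2_eq_square)
  also have "J\<^sup>2 \<le> J\<^sup>2 * (2 * d + 1)" by simp
  finally have "4 * J \<le> q" using large by (simp add: q_def)
  hence l_le: "l \<le> Suc m" "l \<le> CARD('a)" using m by (auto simp: l_def q_def)
  have "l * card {a. poly f a \<noteq> 0 \<and> poly f a ^ m = c} \<le> degree P"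
  proof (rule card_mult_le_degree_of_vanishing[OF P0])
    fix a assume "a \<in> {a. poly f a \<noteq> 0 \<and> poly f a ^ m = c}"
    hence "poly f a \<noteq> 0" "poly f a ^ m = c" by auto
    thus "[:-a, 1:] ^ l dvd P"
      unfolding P_def by (rule auxiliary_poly_vanishes[OF lJ(2) l_le _ _ van])
  qed
  also have "degree P \<le> (J + d) * q"
    unfolding P_def auxiliary_poly_def q_def[symmetric]
  proof (rule degree_sum_le)
    fix j assume j: "j \<in> {..<J}"
    have "degree (r j) \<le> D" "degree (s j) \<le> D"
      using deg j by (auto intro!: degree_le)
    moreover have "degree (f ^ m) \<le> d * m"
      by (rule order.trans[OF degree_power_le mult_le_mono1[OF d]])
    ultimately have "degree (r j + s j * f ^ m) \<le> D + d * m"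
      using degree_mult_le[of "s j" "f ^ m"] by (intro degree_add_le) auto
    moreover have "degree (monom (1::'a) (q * j)) \<le> q * (J - 1)"
      using j by (intro order.trans[OF degree_monom_le] mult_le_mono2) auto
    ultimately have "degree ((r j + s j * f ^ m) * monom 1 (q * j)) \<le>
        D + d * m + q * (J - 1)"
      using degree_mult_le[of "r j + s j * f ^ m" "monom 1 (q * j)"] by linarith
    also have "\<dots> \<le> q + d * q + q * (J - 1)"
      using D_up m by (intro add_mono mult_le_mono2) (auto simp: q_def)
    also have "\<dots> = (J + d) * q"
      using J by (cases J) (auto simp: algebra_simps)
    finally show "degree ((r j + s j * f ^ m) * monom 1 (q * j)) \<le> (J + d) * q" .
  qed simp
  finally show ?thesis by (simp add: l_def q_def)
qed

section \<open>Counting even configurations\<close>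

text \<open>
  The order at the simple root is odd on the left-hand side and even on the right-hand side.
\<close>
lemma nonsquare_if_simple_root:
  fixes g r s :: "'a::field poly"
  assumes "w \<noteq> 0" and g: "poly g (- inverse w) \<noteq> 0" and eq: "[:1, w:] * g * r\<^sup>2 = s\<^sup>2"
  shows "r = 0"
proof (rule ccontr)
  assume r: "r \<noteq> 0"
  define a where "a = - inverse w"
  have g0: "g \<noteq> 0" using g by auto
  have lin: "[:1, w:] = smult w ([:-a, 1:] ^ 1)" using assms(1) by (simp add: a_def)
  have o1: "order a [:1, w:] = 1"
    unfolding lin order_smult[OF assms(1)] by (rule order_power_n_n)
  define L where "L = [:1, w:]"
  have L0: "L \<noteq> 0" by (simp add: L_def)
  note eq' = eq[folded L_def] and o1' = o1[folded L_def]
  have og: "order a g = 0" using g by (simp add: order_root a_def)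
  have nz: "L * g * r\<^sup>2 \<noteq> 0" using g0 r L0 by simp
  hence s: "s \<noteq> 0" using eq' by auto
  have sq: "order a (u\<^sup>2) = 2 * order a u" if "u \<noteq> 0" for u :: "'a poly"
    using that by (simp add: power2_eq_square order_mult)
  have "order a (L * g * r\<^sup>2) = 1 + 2 * order a r"
    using nz by (simp add: order_mult o1' og sq r)
  hence "1 + 2 * order a r = 2 * order a s" unfolding eq' sq[OF s] by simp
  thus False by presburger
qed

lemma prod_power_parity:
  fixes g :: "'b \<Rightarrow> 'a::finite_field"
  assumes m: "CARD('a) = 2 * m + 1" and "finite E" and "\<And>e. e \<in> E \<Longrightarrow> g e \<noteq> 0"
  shows "(\<Prod>e\<in>E. g e) ^ m = (-1) ^ (card E + card {e\<in>E. \<exists>y. g e = y * y})"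
proof -
  have "(\<Prod>e\<in>E. g e) ^ m = (\<Prod>e\<in>E. if \<exists>y. g e = y * y then 1 else -1)"
    unfolding prod_power_distrib
    using assms by (intro prod.cong) (auto simp: euler_criterion_finite_field[OF m])
  also have "\<dots> = (-1) ^ card {e\<in>E. \<not> (\<exists>y. g e = y * y)}"
    using assms(2) by (simp add: prod.If_cases Int_def)
  also have "\<dots> = (-1) ^ (card E + card {e\<in>E. \<exists>y. g e = y * y})"
  proof -
    have "card E = card ({e\<in>E. \<exists>y. g e = y * y} \<union> {e\<in>E. \<not> (\<exists>y. g e = y * y)})"
      by (rule arg_cong[of _ _ card]) auto
    also have "\<dots> = card {e\<in>E. \<exists>y. g e = y * y} + card {e\<in>E. \<not> (\<exists>y. g e = y * y)}"
      using assms(2) by (intro card_Un_disjoint) auto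
    finally show ?thesis by (simp add: power_add flip: power_mult_distrib)
  qed
  finally show ?thesis .
qed

lemma card_le_fibres:
  fixes T :: "('v \<Rightarrow> 'a::{finite,zero}) set"
  assumes V: "finite V" "v \<in> V" and T: "T \<subseteq> V \<rightarrow>\<^sub>E UNIV"
    and b: "\<And>\<psi>. \<psi> \<in> V \<rightarrow>\<^sub>E UNIV \<Longrightarrow> card {x. \<psi>(v := x) \<in> T} \<le> b"
  shows "card T \<le> b * CARD('a) ^ (card V - 1)"
proof -
  let ?R = "(V - {v}) \<rightarrow>\<^sub>E (UNIV :: 'a set)"
  have fin: "finite ?R" using V by (intro finite_PiE) auto
  have "T \<subseteq> (\<Union>\<psi>\<in>?R. (\<lambda>x. \<psi>(v := x)) ` {x. \<psi>(v := x) \<in> T})"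
  proof
    fix \<phi> assume \<phi>: "\<phi> \<in> T"
    have "\<phi>(v := undefined) \<in> ?R" using T \<phi> by (auto simp: PiE_def extensional_def)
    thus "\<phi> \<in> (\<Union>\<psi>\<in>?R. (\<lambda>x. \<psi>(v := x)) ` {x. \<psi>(v := x) \<in> T})"
      using \<phi> by (intro UN_I[of "\<phi>(v := undefined)"] image_eqI[of _ _ "\<phi> v"]) auto
  qed
  hence "card T \<le> card (\<Union>\<psi>\<in>?R. (\<lambda>x. \<psi>(v := x)) ` {x. \<psi>(v := x) \<in> T})"
    using fin by (intro card_mono) auto
  also have "\<dots> \<le> (\<Sum>\<psi>\<in>?R. card ((\<lambda>x. \<psi>(v := x)) ` {x. \<psi>(v := x) \<in> T}))"
    using fin by (rule card_UN_le)
  also have "\<dots> \<le> (\<Sum>\<psi>\<in>?R. b)"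
  proof (rule sum_mono)
    fix \<psi> assume "\<psi> \<in> ?R"
    \<comment> \<open>The value at \<open>v\<close> is overwritten, so any value extends \<open>\<psi>\<close> to \<open>V\<close>.\<close>
    hence "\<psi>(v := 0) \<in> V \<rightarrow>\<^sub>E UNIV" using V(2) by (auto simp: PiE_def extensional_def)
    from b[OF this] have "card {x. \<psi>(v := x) \<in> T} \<le> b" by simp
    thus "card ((\<lambda>x. \<psi>(v := x)) ` {x. \<psi>(v := x) \<in> T}) \<le> b"
      by (intro order.trans[OF card_image_le]) auto
  qed
  also have "\<dots> = b * CARD('a) ^ (card V - 1)"
    using V by (simp add: card_PiE)
  finally show ?thesis .
qed

text \<open>
  The edges of the octahedron fall into those through $u_1(0)$ and those through $u_1(1)$.
\<close>
lemma card_cube_split: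
  assumes "k \<ge> (1::nat)"
  shows "card {\<epsilon> \<in> {1..k} \<rightarrow>\<^sub>E {0, 1::nat}. P \<epsilon>} =
    card {\<epsilon> \<in> {2..k} \<rightarrow>\<^sub>E {0, 1}. P (\<epsilon>(1 := 0))} + card {\<epsilon> \<in> {2..k} \<rightarrow>\<^sub>E {0, 1}. P (\<epsilon>(1 := 1))}"
proof -
  define E where "E = ({2..k} \<rightarrow>\<^sub>E {0, 1::nat})"
  have finE: "finite E" unfolding E_def by (intro finite_PiE) auto
  have ins: "{1..k} = insert 1 {2..k}" using assms by auto
  have inj: "inj_on (\<lambda>\<epsilon>. \<epsilon>(1 := b)) {\<epsilon> \<in> E. Q \<epsilon>}" for b and Q :: "(nat \<Rightarrow> nat) \<Rightarrow> bool"
  proof (rule inj_onI)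
    fix \<epsilon> \<epsilon>' assume *: "\<epsilon> \<in> {\<epsilon> \<in> E. Q \<epsilon>}" "\<epsilon>' \<in> {\<epsilon> \<in> E. Q \<epsilon>}" and "\<epsilon>(1 := b) = \<epsilon>'(1 := b)"
    hence "\<epsilon>(1 := b, 1 := undefined) = \<epsilon>'(1 := b, 1 := undefined)" by simp
    moreover have "\<epsilon> 1 = undefined" "\<epsilon>' 1 = undefined"
      using * by (auto simp: E_def PiE_def extensional_def)
    ultimately show "\<epsilon> = \<epsilon>'" by (metis fun_upd_upd fun_upd_triv)
  qed
  have "{\<epsilon> \<in> {1..k} \<rightarrow>\<^sub>E {0, 1::nat}. P \<epsilon>} =
      (\<lambda>\<epsilon>. \<epsilon>(1 := 0)) ` {\<epsilon> \<in> E. P (\<epsilon>(1 := 0))} \<union> (\<lambda>\<epsilon>. \<epsilon>(1 := 1)) ` {\<epsilon> \<in> E. P (\<epsilon>(1 := 1))}"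
    unfolding ins PiE_insert_eq E_def by auto
  hence "card {\<epsilon> \<in> {1..k} \<rightarrow>\<^sub>E {0, 1::nat}. P \<epsilon>} =
      card ((\<lambda>\<epsilon>. \<epsilon>(1 := 0)) ` {\<epsilon> \<in> E. P (\<epsilon>(1 := 0))} \<union> (\<lambda>\<epsilon>. \<epsilon>(1 := 1)) ` {\<epsilon> \<in> E. P (\<epsilon>(1 := 1))})"
    by (rule arg_cong)
  also have "\<dots> = card ((\<lambda>\<epsilon>. \<epsilon>(1 := 0)) ` {\<epsilon> \<in> E. P (\<epsilon>(1 := 0))}) +
      card ((\<lambda>\<epsilon>. \<epsilon>(1 := 1)) ` {\<epsilon> \<in> E. P (\<epsilon>(1 := 1))})"
  proof (rule card_Un_disjoint)
    show "(\<lambda>\<epsilon>. \<epsilon>(1 := 0)) ` {\<epsilon> \<in> E. P (\<epsilon>(1 := 0))} \<inter> (\<lambda>\<epsilon>. \<epsilon>(1 := 1)) ` {\<epsilon> \<in> E. P (\<epsilon>(1 := 1))} = {}"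
    proof (rule equals0I)
      fix \<epsilon> assume *: "\<epsilon> \<in> (\<lambda>\<epsilon>. \<epsilon>(1 := 0)) ` {\<epsilon> \<in> E. P (\<epsilon>(1 := 0))} \<inter> (\<lambda>\<epsilon>. \<epsilon>(1 := 1)) ` {\<epsilon> \<in> E. P (\<epsilon>(1 := 1))}"
      from * have "\<epsilon> 1 = 0" by (elim IntE imageE) (simp only: fun_upd_same)
      moreover from * have "\<epsilon> 1 = 1" by (elim IntE imageE) (simp only: fun_upd_same)
      ultimately show False by simp
    qed
  qed (use finE in simp_all)
  also have "card ((\<lambda>\<epsilon>. \<epsilon>(1 := 0)) ` {\<epsilon> \<in> E. P (\<epsilon>(1 := 0))}) = card {\<epsilon> \<in> E. P (\<epsilon>(1 := 0))}"
    by (rule card_image, rule inj)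
  also have "card ((\<lambda>\<epsilon>. \<epsilon>(1 := 1)) ` {\<epsilon> \<in> E. P (\<epsilon>(1 := 1))}) = card {\<epsilon> \<in> E. P (\<epsilon>(1 := 1))}"
    by (rule card_image, rule inj)
  finally show ?thesis by (simp only: E_def)
qed


text \<open>
  The vertex $u_i(\epsilon)$ of the octahedron is sent to \<open>\<phi> (i, \<epsilon>)\<close>.
  Repeated vertices are admitted here, which can only increase the count.
\<close>
definition even_cubes :: "nat \<Rightarrow> (nat \<times> nat \<Rightarrow> 'a::finite_field) set" where
  "even_cubes k = {\<phi> \<in> ({1..k} \<times> {0, 1}) \<rightarrow>\<^sub>E UNIV.
     even (card {\<epsilon> \<in> {1..k} \<rightarrow>\<^sub>E {0, 1}. \<exists>y. (\<Prod>i\<in>{1..k}. \<phi> (i, \<epsilon> i)) + 1 = y * y})}"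

text \<open>
  The factor that multiplies the vertex of index 1 in the product over the edge $\epsilon$.
\<close>
definition weight :: "nat \<Rightarrow> (nat \<times> nat \<Rightarrow> 'a::comm_monoid_mult) \<Rightarrow> (nat \<Rightarrow> nat) \<Rightarrow> 'a" where
  "weight k \<phi> \<epsilon> = (\<Prod>i\<in>{2..k}. \<phi> (i, \<epsilon> i))"

definition zero_index :: "nat \<Rightarrow> nat \<Rightarrow> nat" where
  "zero_index k = restrict (\<lambda>_. 0) {2..k}"

text \<open>
  Under this condition \<open>- 1 / weight k \<phi> (zero_index k)\<close> is a simple root of the product of
  the linear factors $1 + w X$ over all weights $w$.
\<close>
definition nondegenerate :: "nat \<Rightarrow> (nat \<times> nat \<Rightarrow> 'a::finite_field) \<Rightarrow> bool" where
  "nondegenerate k \<phi> \<longleftrightarrow> (\<forall>i\<in>{2..k}. \<phi> (i, 0) \<noteq> 0) \<and>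
     (\<forall>\<epsilon>\<in>({2..k} \<rightarrow>\<^sub>E {0, 1}) - {zero_index k}. weight k \<phi> \<epsilon> \<noteq> weight k \<phi> (zero_index k))"

text \<open>
  Let $x = u_1(0)$ vary and fix all other vertices. The parity of the number of edges through
  $u_1(1)$ is fixed, so evenness prescribes the parity of the number of squares among the values
  $1 + w x$. Unless one of them is zero, that is the value of $f(x)^m = \prod (1 + w x)^m$, where $f$
  is the product of the linear factors $1 + w X$.
\<close>
lemma card_even_fibre:
  fixes \<psi> :: "nat \<times> nat \<Rightarrow> 'a::finite_field"
  assumes k: "k \<ge> 2" and odd: "odd CARD('a)" and J: "J > 0"
    and large: "CARD('a) \<ge> 2 ^ k + 3 + 4 * J\<^sup>2 * (2 * 2 ^ k + 1)"
    and nd: "nondegenerate k \<psi>"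
  shows "card {x. \<psi>((1, 0) := x) \<in> even_cubes k} \<le> 2 ^ k + (J + 2 ^ k) * CARD('a) div (2 * J - 1)"
proof -
  obtain m where m: "CARD('a) = 2 * m + 1" using odd by (rule oddE)
  define E where "E = ({2..k} \<rightarrow>\<^sub>E {0, 1::nat})"
  define w where "w = weight k \<psi>"
  define o0 where "o0 = zero_index k"
  have finE: "finite E" unfolding E_def by (intro finite_PiE) auto
  have oE: "o0 \<in> E" by (auto simp: E_def o0_def zero_index_def)
  have w0: "w o0 \<noteq> 0"
    using nd by (auto simp: w_def weight_def o0_def zero_index_def nondegenerate_def)
  define f where "f = (\<Prod>\<epsilon>\<in>E. [:1, w \<epsilon>:])"
  define g where "g = (\<Prod>\<epsilon>\<in>E - {o0}. [:1, w \<epsilon>:])"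
  have fg: "f = [:1, w o0:] * g"
    unfolding f_def g_def by (rule prod.remove[OF finE oE])
  have f0: "poly f 0 = 1" by (simp add: f_def poly_prod)
  have pf: "poly f x = (\<Prod>\<epsilon>\<in>E. x * w \<epsilon> + 1)" for x
    by (simp add: f_def poly_prod add.commute)
  have "card E = 2 ^ (k - 1)" unfolding E_def by (simp add: card_PiE numeral_2_eq_2)
  hence cardE: "card E \<le> 2 ^ k" by (simp add: power_increasing)
  have "degree f \<le> (\<Sum>\<epsilon>\<in>E. degree [:1, w \<epsilon>:])"
    unfolding f_def using degree_prod_sum_le[OF finE, of "\<lambda>\<epsilon>. [:1, w \<epsilon>:]"] unfolding o_def .
  also have "\<dots> \<le> (\<Sum>\<epsilon>\<in>E. 1)" by (rule sum_mono) simp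
  finally have df: "degree f \<le> 2 ^ k" using cardE by simp
  have "poly g (- inverse (w o0)) \<noteq> 0"
  proof -
    have ne: "w \<epsilon> \<noteq> w o0" if "\<epsilon> \<in> E - {o0}" for \<epsilon>
      using nd that by (auto simp: nondegenerate_def w_def o0_def E_def)
    have "poly [:1, w \<epsilon>:] (- inverse (w o0)) \<noteq> 0" if "\<epsilon> \<in> E - {o0}" for \<epsilon>
      using ne[OF that] w0 by (simp add: field_simps)
    thus ?thesis
      unfolding g_def poly_prod using finE by (subst prod_zero_iff) blast+
  qed
  hence nonsq: "r = 0" if "f * r\<^sup>2 = s\<^sup>2" for r s
    using that unfolding fg by (rule nonsquare_if_simple_root[OF w0])
  define n1 where "n1 = card {\<epsilon>\<in>E. \<exists>y. \<psi> (1, 1) * w \<epsilon> + 1 = y * y}"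
  define c :: 'a where "c = (-1) ^ (card E + n1)"
  have "poly f x ^ m = c" if x: "\<psi>((1, 0) := x) \<in> even_cubes k" "poly f x \<noteq> 0" for x
  proof -
    define \<phi> where "\<phi> = \<psi>((1, 0) := x)"
    define nx where "nx = card {\<epsilon>\<in>E. \<exists>y. x * w \<epsilon> + 1 = y * y}"
    have split1: "(\<Prod>i\<in>{1..k}. \<phi> (i, (\<epsilon>(1 := b)) i)) = \<phi> (1, b) * w \<epsilon>" for \<epsilon> b
    proof -
      have "{1..k} = insert 1 {2..k}" using k by auto
      hence "(\<Prod>i\<in>{1..k}. \<phi> (i, (\<epsilon>(1 := b)) i)) =
          \<phi> (1, b) * (\<Prod>i\<in>{2..k}. \<phi> (i, (\<epsilon>(1 := b)) i))" by simp
      also have "(\<Prod>i\<in>{2..k}. \<phi> (i, (\<epsilon>(1 := b)) i)) = w \<epsilon>"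
        unfolding w_def weight_def by (rule prod.cong) (auto simp: \<phi>_def)
      finally show ?thesis .
    qed
    have "even (card {\<epsilon> \<in> {1..k} \<rightarrow>\<^sub>E {0, 1}. \<exists>y. (\<Prod>i\<in>{1..k}. \<phi> (i, \<epsilon> i)) + 1 = y * y})"
      using x(1) by (simp add: even_cubes_def \<phi>_def)
    also have "card {\<epsilon> \<in> {1..k} \<rightarrow>\<^sub>E {0, 1}. \<exists>y. (\<Prod>i\<in>{1..k}. \<phi> (i, \<epsilon> i)) + 1 = y * y} = nx + n1"
      using k by (subst card_cube_split) (simp_all only: split1, simp_all add: nx_def n1_def E_def \<phi>_def)
    finally have par: "even (nx + n1)" .
    \<comment> \<open>Modulo 2 the number of nonsquares is \<open>card E + nx\<close>, hence \<open>card E + n1\<close>.\<close>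
    have "poly f x ^ m = (-1) ^ (card E + nx)"
      unfolding pf nx_def using x(2) finE by (intro prod_power_parity m) (auto simp: pf prod_zero_iff)
    also have "\<dots> = c"
      unfolding c_def using par by (simp add: minus_one_power_iff)
    finally show ?thesis .
  qed
  hence "{x. \<psi>((1, 0) := x) \<in> even_cubes k} \<subseteq>
      {x. poly f x = 0} \<union> {a. poly f a \<noteq> 0 \<and> poly f a ^ m = c}" by blast
  hence "card {x. \<psi>((1, 0) := x) \<in> even_cubes k} \<le>
      card ({x. poly f x = 0} \<union> {a. poly f a \<noteq> 0 \<and> poly f a ^ m = c})"
    by (intro card_mono) auto
  also have "\<dots> \<le> card {x. poly f x = 0} + card {a. poly f a \<noteq> 0 \<and> poly f a ^ m = c}"
    by (rule card_Un_le)
  also have "\<dots> \<le> 2 ^ k + (J + 2 ^ k) * CARD('a) div (2 * J - 1)"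
  proof (rule add_mono)
    have "f \<noteq> 0" using f0 by auto
    thus "card {x. poly f x = 0} \<le> 2 ^ k"
      using card_poly_roots_bound[of f] df by simp
    have "(2 * J - 1) * card {a. poly f a \<noteq> 0 \<and> poly f a ^ m = c} \<le> (J + 2 ^ k) * CARD('a)"
      by (rule stepanov_bound[OF m f0 df nonsq J large])
    thus "card {a. poly f a \<noteq> 0 \<and> poly f a ^ m = c} \<le> (J + 2 ^ k) * CARD('a) div (2 * J - 1)"
      using J by (simp add: less_eq_div_iff_mult_less_eq mult.commute)
  qed
  finally show ?thesis .
qed

text \<open>
  Every way of being degenerate is an equation that determines one coordinate by the others:
  either $u_i(0) = 0$, or two weights agree, and since the second of them is not zero the equation
  can be solved for some $u_i(1)$ that occurs in the first.
\<close>
lemma card_degenerate: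
  assumes k: "k \<ge> 2"
  shows "card {\<phi> \<in> ({1..k} \<times> {0, 1}) \<rightarrow>\<^sub>E (UNIV :: 'a::finite_field set). \<not> nondegenerate k \<phi>} \<le>
    (2 ^ k + k) * CARD('a) ^ (2 * k - 1)"
proof -
  define V where "V = {1..k} \<times> {0, 1::nat}"
  define Fs where "Fs = V \<rightarrow>\<^sub>E (UNIV :: 'a set)"
  define E where "E = ({2..k} \<rightarrow>\<^sub>E {0, 1::nat})"
  define q where "q = CARD('a)"
  have V: "finite V" "card V = 2 * k" by (simp_all add: V_def card_cartesian_product)
  have finFs: "finite Fs" unfolding Fs_def using V by (intro finite_PiE) auto
  have finE: "finite E" unfolding E_def by (intro finite_PiE) auto
  have "card E = 2 ^ (k - 1)" unfolding E_def by (simp add: card_PiE numeral_2_eq_2)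
  hence cardE: "card E \<le> 2 ^ k" by (simp add: power_increasing)
  define Z where "Z = (\<lambda>i. {\<phi>\<in>Fs. \<phi> (i, 0) = 0})"
  define C where "C = (\<lambda>\<epsilon>. {\<phi>\<in>Fs. (\<forall>i\<in>{2..k}. \<phi> (i, 0) \<noteq> 0) \<and> weight k \<phi> \<epsilon> = weight k \<phi> (zero_index k)})"
  have Z: "card (Z i) \<le> q ^ (2 * k - 1)" if i: "i \<in> {2..k}" for i
  proof -
    have "card (Z i) \<le> 1 * CARD('a) ^ (card V - 1)"
    proof (rule card_le_fibres[OF V(1), of "(i, 0)"])
      fix \<psi> :: "nat \<times> nat \<Rightarrow> 'a"
      have "{x. \<psi>((i, 0) := x) \<in> Z i} \<subseteq> {0}" by (auto simp: Z_def)
      from card_mono[OF _ this] show "card {x. \<psi>((i, 0) := x) \<in> Z i} \<le> 1" by simp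
    qed (use i in \<open>auto simp: V_def Z_def Fs_def\<close>)
    thus ?thesis by (simp add: V q_def)
  qed
  have C: "card (C \<epsilon>) \<le> q ^ (2 * k - 1)" if \<epsilon>: "\<epsilon> \<in> E - {zero_index k}" for \<epsilon>
  proof -
    have "\<exists>i\<in>{2..k}. \<epsilon> i \<noteq> 0"
    proof (rule ccontr)
      assume "\<not> ?thesis"
      hence "\<epsilon> = zero_index k" using \<epsilon> by (auto simp: E_def zero_index_def fun_eq_iff PiE_def extensional_def)
      thus False using \<epsilon> by simp
    qed
    then obtain i where i: "i \<in> {2..k}" and "\<epsilon> i \<noteq> 0" by blast
    hence \<epsilon>i: "\<epsilon> i = 1" using \<epsilon> by (auto simp: E_def PiE_def Pi_def)
    have "card (C \<epsilon>) \<le> 1 * CARD('a) ^ (card V - 1)"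
    proof (rule card_le_fibres[OF V(1), of "(i, 1)"])
      fix \<psi> :: "nat \<times> nat \<Rightarrow> 'a"
      define A where "A = (\<Prod>j\<in>{2..k} - {i}. \<psi> (j, \<epsilon> j))"
      have wx: "weight k (\<psi>((i, 1) := x)) \<epsilon> = x * A" for x
      proof -
        have "weight k (\<psi>((i, 1) := x)) \<epsilon> =
            x * (\<Prod>j\<in>{2..k} - {i}. (\<psi>((i, 1) := x)) (j, \<epsilon> j))"
          unfolding weight_def using i \<epsilon>i by (subst prod.remove[of _ i]) auto
        also have "(\<Prod>j\<in>{2..k} - {i}. (\<psi>((i, 1) := x)) (j, \<epsilon> j)) = A"
          unfolding A_def by (rule prod.cong) auto
        finally show ?thesis .
      qed
      have w0: "weight k (\<psi>((i, 1) := x)) (zero_index k) = weight k \<psi> (zero_index k)" for x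
        unfolding weight_def by (rule prod.cong) (auto simp: zero_index_def)
      have nz: "weight k \<psi> (zero_index k) \<noteq> 0" if "\<psi>((i, 1) := x) \<in> C \<epsilon>" for x
        using that by (auto simp: C_def weight_def zero_index_def)
      have "x * A = weight k \<psi> (zero_index k)" if "\<psi>((i, 1) := x) \<in> C \<epsilon>" for x
        using that wx w0 by (simp add: C_def)
      hence "x = weight k \<psi> (zero_index k) / A" if "\<psi>((i, 1) := x) \<in> C \<epsilon>" for x
        using nz[OF that] that by (metis mult_zero_right nonzero_eq_divide_eq)
      hence "{x. \<psi>((i, 1) := x) \<in> C \<epsilon>} \<subseteq> {weight k \<psi> (zero_index k) / A}" by blast
      from card_mono[OF _ this] show "card {x. \<psi>((i, 1) := x) \<in> C \<epsilon>} \<le> 1" by simp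
    qed (use i in \<open>auto simp: V_def C_def Fs_def\<close>)
    thus ?thesis by (simp add: V q_def)
  qed
  have "{\<phi>\<in>Fs. \<not> nondegenerate k \<phi>} \<subseteq> (\<Union>i\<in>{2..k}. Z i) \<union> (\<Union>\<epsilon>\<in>E - {zero_index k}. C \<epsilon>)"
    by (auto simp: nondegenerate_def Z_def C_def E_def)
  hence "card {\<phi>\<in>Fs. \<not> nondegenerate k \<phi>} \<le>
      card ((\<Union>i\<in>{2..k}. Z i) \<union> (\<Union>\<epsilon>\<in>E - {zero_index k}. C \<epsilon>))"
    using finFs finE by (intro card_mono) (auto simp: Z_def C_def)
  also have "\<dots> \<le> card (\<Union>i\<in>{2..k}. Z i) + card (\<Union>\<epsilon>\<in>E - {zero_index k}. C \<epsilon>)"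
    by (rule card_Un_le)
  also have "\<dots> \<le> (\<Sum>i\<in>{2..k}. card (Z i)) + (\<Sum>\<epsilon>\<in>E - {zero_index k}. card (C \<epsilon>))"
    using finE by (intro add_mono card_UN_le) auto
  also have "\<dots> \<le> (\<Sum>i\<in>{2..k}. q ^ (2 * k - 1)) + (\<Sum>\<epsilon>\<in>E - {zero_index k}. q ^ (2 * k - 1))"
    using Z C by (intro add_mono sum_mono) auto
  also have "\<dots> = (k - 1) * q ^ (2 * k - 1) + card (E - {zero_index k}) * q ^ (2 * k - 1)"
    by simp
  also have "\<dots> \<le> k * q ^ (2 * k - 1) + 2 ^ k * q ^ (2 * k - 1)"
    using cardE card_Diff1_le[of E "zero_index k"] by (intro add_mono mult_le_mono1) auto
  finally show ?thesis by (simp add: Fs_def V_def q_def algebra_simps)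
qed

theorem card_even_cubes:
  assumes k: "k \<ge> 2" and odd: "odd CARD('a::finite_field)" and J: "J > 0"
    and large: "CARD('a) \<ge> 2 ^ k + 3 + 4 * J\<^sup>2 * (2 * 2 ^ k + 1)"
  shows "(2 * J - 1) * card (even_cubes k :: (nat \<times> nat \<Rightarrow> 'a) set) \<le>
    ((J + 2 ^ k) * CARD('a) + (2 * J - 1) * (2 * 2 ^ k + k)) * CARD('a) ^ (2 * k - 1)"
proof -
  define V where "V = {1..k} \<times> {0, 1::nat}"
  define Fs where "Fs = V \<rightarrow>\<^sub>E (UNIV :: 'a set)"
  define q where "q = CARD('a)"
  define B where "B = (J + 2 ^ k) * q div (2 * J - 1)"
  have V: "finite V" "card V = 2 * k" by (simp_all add: V_def card_cartesian_product)
  have finFs: "finite Fs" unfolding Fs_def using V by (intro finite_PiE) auto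
  define G where "G = {\<phi>\<in>even_cubes k. nondegenerate k (\<phi> :: _ \<Rightarrow> 'a)}"
  have sub: "even_cubes k \<subseteq> Fs" by (auto simp: even_cubes_def Fs_def V_def)
  have GF: "G \<subseteq> Fs" using sub by (auto simp: G_def)
  have "card G \<le> (2 ^ k + B) * CARD('a) ^ (card V - 1)"
  proof (rule card_le_fibres[OF V(1), of "(1, 0)"])
    fix \<psi> :: "nat \<times> nat \<Rightarrow> 'a"
    have nd: "nondegenerate k (\<psi>((1, 0) := x)) = nondegenerate k \<psi>" for x
    proof -
      have "weight k (\<psi>((1, 0) := x)) = weight k \<psi>"
        unfolding weight_def fun_eq_iff by (auto intro!: prod.cong)
      thus ?thesis by (simp add: nondegenerate_def)
    qed
    show "card {x. \<psi>((1, 0) := x) \<in> G} \<le> 2 ^ k + B"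
    proof (cases "nondegenerate k \<psi>")
      case True
      from card_even_fibre[OF k odd J large this] show ?thesis
        unfolding G_def mem_Collect_eq nd using True by (simp add: B_def q_def)
    next
      case False
      thus ?thesis unfolding G_def mem_Collect_eq nd by simp
    qed
  qed (use k in \<open>simp add: V_def\<close>, use GF in \<open>simp only: Fs_def\<close>)
  hence G: "card G \<le> (2 ^ k + B) * q ^ (2 * k - 1)" by (simp add: V q_def)
  have "even_cubes k \<subseteq> G \<union> {\<phi>\<in>Fs. \<not> nondegenerate k \<phi>}"
    using sub by (auto simp: G_def)
  hence "card (even_cubes k :: (nat \<times> nat \<Rightarrow> 'a) set) \<le> card (G \<union> {\<phi>\<in>Fs. \<not> nondegenerate k \<phi>})"
    using finFs sub by (intro card_mono) (auto simp: G_def intro: finite_subset)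
  also have "\<dots> \<le> card G + card {\<phi>\<in>Fs. \<not> nondegenerate k \<phi>}"
    by (rule card_Un_le)
  also have "\<dots> \<le> (2 ^ k + B) * q ^ (2 * k - 1) + (2 ^ k + k) * q ^ (2 * k - 1)"
    using G card_degenerate[OF k, where ?'a = 'a] by (intro add_mono) (simp_all add: Fs_def V_def q_def)
  also have "\<dots> = (B + (2 * 2 ^ k + k)) * q ^ (2 * k - 1)"
    by (simp add: algebra_simps)
  finally have "(2 * J - 1) * card (even_cubes k :: (nat \<times> nat \<Rightarrow> 'a) set) \<le>
      (2 * J - 1) * ((B + (2 * 2 ^ k + k)) * q ^ (2 * k - 1))"
    by (rule mult_le_mono2)
  also have "\<dots> = ((2 * J - 1) * B + (2 * J - 1) * (2 * 2 ^ k + k)) * q ^ (2 * k - 1)"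
    by (simp only: add_mult_distrib2[symmetric] mult.assoc)
  also have "\<dots> \<le> ((J + 2 ^ k) * q + (2 * J - 1) * (2 * 2 ^ k + k)) * q ^ (2 * k - 1)"
    unfolding B_def by (intro mult_le_mono1 add_mono) (simp_all add: mult.commute div_times_less_eq_dividend)
  finally show ?thesis by (simp add: q_def)
qed

section \<open>From types to carrier sets\<close>
definition even_tuples :: "nat \<Rightarrow> 'a ring \<Rightarrow> (nat \<times> nat \<Rightarrow> 'a) set" where
  "even_tuples k F = {\<phi> \<in> ({1..k} \<times> {0, 1}) \<rightarrow>\<^sub>E carrier F.
     even (card {\<epsilon> \<in> {1..k} \<rightarrow>\<^sub>E {0, 1}. is_square_in F (prod_plus_one k F (\<lambda>i. \<phi> (i, \<epsilon> i)))})}"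

lemma prod_plus_one_ring_iso:
  assumes F: "cring F" and F': "cring F'" and h: "h \<in> ring_iso F F'"
    and a: "\<And>i. i \<in> {1..k} \<Longrightarrow> a i \<in> carrier F"
    and b: "\<And>i. i \<in> {1..k} \<Longrightarrow> b i = h (a i)"
  shows "prod_plus_one k F' b = h (prod_plus_one k F a)"
proof -
  interpret F: cring F by (rule F)
  interpret F': cring F' by (rule F')
  note h' = ring_iso_memE[OF h]
  have "finite I \<Longrightarrow> I \<subseteq> {1..k} \<Longrightarrow> (\<Otimes>\<^bsub>F'\<^esub>i\<in>I. b i) = h (\<Otimes>\<^bsub>F\<^esub>i\<in>I. a i)" for I
  proof (induction I rule: finite_induct)
    case empty
    show ?case by (simp add: h')
  next
    case (insert i I)
    have aI: "a \<in> I \<rightarrow> carrier F" "a i \<in> carrier F" using insert.prems a by auto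
    have bI: "b \<in> I \<rightarrow> carrier F'" "b i \<in> carrier F'"
      using insert.prems a b h'(1) by auto
    show ?case
      using insert aI bI b by (simp add: h'(2))
  qed
  from this[of "{1..k}"] have "(\<Otimes>\<^bsub>F'\<^esub>i\<in>{1..k}. b i) = h (\<Otimes>\<^bsub>F\<^esub>i\<in>{1..k}. a i)" by simp
  moreover have "(\<Otimes>\<^bsub>F\<^esub>i\<in>{1..k}. a i) \<in> carrier F" using a by (intro F.finprod_closed) auto
  ultimately show ?thesis
    unfolding prod_plus_one_def by (simp only: h' F.one_closed)
qed

lemma is_square_in_ring_iso:
  assumes "ring F" and h: "h \<in> ring_iso F F'" and x: "x \<in> carrier F"
  shows "is_square_in F' (h x) \<longleftrightarrow> is_square_in F x"
proof -
  interpret F: ring F by fact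
  note h' = ring_iso_memE[OF h]
  have inj: "inj_on h (carrier F)" and im: "h ` carrier F = carrier F'"
    using h'(5) by (auto simp: bij_betw_def)
  have "is_square_in F' (h x) \<longleftrightarrow> (\<exists>y\<in>carrier F. h x = h y \<otimes>\<^bsub>F'\<^esub> h y)"
    unfolding is_square_in_def im[symmetric] by blast
  also have "\<dots> \<longleftrightarrow> (\<exists>y\<in>carrier F. h x = h (y \<otimes>\<^bsub>F\<^esub> y))"
    by (intro bex_cong refl) (simp add: h'(2))
  also have "\<dots> \<longleftrightarrow> (\<exists>y\<in>carrier F. x = y \<otimes>\<^bsub>F\<^esub> y)"
    by (intro bex_cong refl inj_on_eq_iff[OF inj] x) simp
  finally show ?thesis unfolding is_square_in_def .
qed

text \<open>
  Composition with the isomorphism preserves evenness, because being a square is preserved.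
\<close>
lemma card_even_tuples_ring_iso:
  assumes F: "cring F" and F': "cring F'" and h: "h \<in> ring_iso F F'" and fin: "finite (carrier F)"
  shows "card (even_tuples k F) \<le> card (even_tuples k F')"
proof -
  interpret F: cring F by (rule F)
  note h' = ring_iso_memE[OF h]
  have inj: "inj_on h (carrier F)" and im: "h ` carrier F = carrier F'"
    using h'(5) by (auto simp: bij_betw_def)
  define V where "V = {1..k} \<times> {0, 1::nat}"
  have finF': "finite (carrier F')" using fin im by (metis finite_imageI)
  show ?thesis
  proof (rule card_inj_on_le)
    show "finite (even_tuples k F')"
      by (rule finite_subset[OF _ finite_PiE[of V "\<lambda>_. carrier F'"]])
        (auto simp: even_tuples_def V_def finF')
    show "inj_on (\<lambda>\<phi>. restrict (h \<circ> \<phi>) V) (even_tuples k F)"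
    proof (rule inj_onI)
      fix \<phi> \<psi> assume \<phi>: "\<phi> \<in> even_tuples k F" and \<psi>: "\<psi> \<in> even_tuples k F"
        and eq: "restrict (h \<circ> \<phi>) V = restrict (h \<circ> \<psi>) V"
      have P: "\<phi> \<in> V \<rightarrow>\<^sub>E carrier F" "\<psi> \<in> V \<rightarrow>\<^sub>E carrier F"
        using \<phi> \<psi> by (auto simp: even_tuples_def V_def)
      show "\<phi> = \<psi>"
      proof (rule PiE_ext[OF P])
        fix v assume v: "v \<in> V"
        have "h (\<phi> v) = h (\<psi> v)" using fun_cong[OF eq, of v] v by simp
        thus "\<phi> v = \<psi> v" using inj P v by (meson PiE_mem inj_onD)
      qed
    qed
    show "(\<lambda>\<phi>. restrict (h \<circ> \<phi>) V) ` even_tuples k F \<subseteq> even_tuples k F'"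
    proof (rule image_subsetI)
      fix \<phi> assume \<phi>: "\<phi> \<in> even_tuples k F"
      hence P: "\<phi> \<in> V \<rightarrow>\<^sub>E carrier F" by (auto simp: even_tuples_def V_def)
      define \<psi> where "\<psi> = restrict (h \<circ> \<phi>) V"
      have "is_square_in F' (prod_plus_one k F' (\<lambda>i. \<psi> (i, \<epsilon> i))) \<longleftrightarrow>
          is_square_in F (prod_plus_one k F (\<lambda>i. \<phi> (i, \<epsilon> i)))"
        if \<epsilon>: "\<epsilon> \<in> {1..k} \<rightarrow>\<^sub>E {0, 1}" for \<epsilon>
      proof -
        have inV: "(i, \<epsilon> i) \<in> V" if "i \<in> {1..k}" for i
          using \<epsilon> that by (auto simp: V_def PiE_iff)
        have c: "\<phi> (i, \<epsilon> i) \<in> carrier F" if "i \<in> {1..k}" for i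
          using inV[OF that] P by (meson PiE_mem)
        have "prod_plus_one k F' (\<lambda>i. \<psi> (i, \<epsilon> i)) = h (prod_plus_one k F (\<lambda>i. \<phi> (i, \<epsilon> i)))"
          by (rule prod_plus_one_ring_iso[OF F F' h c]) (use inV in \<open>auto simp: \<psi>_def\<close>)
        moreover have "prod_plus_one k F (\<lambda>i. \<phi> (i, \<epsilon> i)) \<in> carrier F"
          unfolding prod_plus_one_def using c by (intro F.a_closed F.finprod_closed F.one_closed) auto
        ultimately show ?thesis
          using is_square_in_ring_iso[OF F.ring_axioms h] by simp
      qed
      hence "{\<epsilon> \<in> {1..k} \<rightarrow>\<^sub>E {0, 1}. is_square_in F' (prod_plus_one k F' (\<lambda>i. \<psi> (i, \<epsilon> i)))} =
          {\<epsilon> \<in> {1..k} \<rightarrow>\<^sub>E {0, 1}. is_square_in F (prod_plus_one k F (\<lambda>i. \<phi> (i, \<epsilon> i)))}"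
        by blast
      moreover have "\<psi> \<in> V \<rightarrow>\<^sub>E carrier F'"
        using P h'(1) by (auto simp: \<psi>_def PiE_iff)
      ultimately show "\<psi> \<in> even_tuples k F'"
        using \<phi> unfolding even_tuples_def V_def by simp
    qed
  qed
qed

definition type_ring :: "'a::comm_ring_1 ring" where
  "type_ring = \<lparr>carrier = UNIV, monoid.mult = (*), one = 1, zero = 0, add = (+)\<rparr>"

lemma type_ring_simps [simp]:
  "carrier type_ring = UNIV" "x \<otimes>\<^bsub>type_ring\<^esub> y = x * y" "\<one>\<^bsub>type_ring\<^esub> = 1"
  "\<zero>\<^bsub>type_ring\<^esub> = 0" "x \<oplus>\<^bsub>type_ring\<^esub> y = x + y"
  by (simp_all add: type_ring_def)

lemma cring_type_ring: "cring (type_ring :: 'a::comm_ring_1 ring)"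
proof -
  have "\<exists>y. x + y = 0" for x :: 'a using add.right_inverse by blast
  thus ?thesis
    using add.right_inverse by unfold_locales (auto simp: algebra_simps Units_def)
qed

lemma even_tuples_type_ring: "even_tuples k (type_ring :: 'a::finite_field ring) = even_cubes k"
proof -
  interpret cring "type_ring :: 'a ring" by (rule cring_type_ring)
  have "finprod (type_ring :: 'a ring) a I = (\<Prod>i\<in>I. a i)" if "finite I" for a and I :: "nat set"
    using that by (induction I rule: finite_induct) auto
  thus ?thesis
    by (simp add: even_tuples_def even_cubes_def is_square_in_def prod_plus_one_def)
qed

text \<open>
  The conclusion of \<open>card_even_cubes\<close> as a property of a ring, for all $k$ and $J$ at once so
  that the ring is the only parameter.
\<close>
definition few_even_tuples :: "'a ring \<Rightarrow> bool" where
  "few_even_tuples F \<longleftrightarrow> (\<forall>k\<ge>2. \<forall>J>0. let q = card (carrier F) in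
     2 ^ k + 3 + 4 * J\<^sup>2 * (2 * 2 ^ k + 1) \<le> q \<longrightarrow>
     (2 * J - 1) * card (even_tuples k F) \<le>
       ((J + 2 ^ k) * q + (2 * J - 1) * (2 * 2 ^ k + k)) * q ^ (2 * k - 1))"

lemma few_even_tuples_type_ring:
  assumes "odd CARD('a::finite_field)"
  shows "few_even_tuples (type_ring :: 'a ring)"
  using card_even_cubes[OF _ assms]
  by (auto simp: few_even_tuples_def even_tuples_type_ring Let_def)

lemma few_even_tuples_ring_iso:
  assumes "cring F" "cring F'" "h \<in> ring_iso F F'" "finite (carrier F)" "few_even_tuples F'"
  shows "few_even_tuples F"
proof -
  have "card (carrier F) = card (carrier F')"
    using ring_iso_memE(5)[OF assms(3)] by (rule bij_betw_same_card)
  thus ?thesis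
    using assms(5) order.trans[OF mult_le_mono2[OF card_even_tuples_ring_iso[OF assms(1-4)]]]
    unfolding few_even_tuples_def Let_def by simp
qed

definition finite_odd_field :: "'a ring \<Rightarrow> bool" where
  "finite_odd_field F \<longleftrightarrow> field F \<and> finite (carrier F) \<and> odd (card (carrier F))"

text \<open>
  The bound above is about types of class \<open>finite_field\<close>, and it is needed for a field $F$ that
  is a variable. No type can depend on $F$, but a type can be defined from a closed term. So choose,
  once and for all, a finite field of odd order that violates the bound if there is one that does.
  Its carrier is a type of class \<open>finite_field\<close>, so it satisfies the bound after all, and
  therefore all the others do. Carriers within the integers suffice up to isomorphism.
\<close>
definition critical_ring :: "int ring" where
  "critical_ring = (SOME F. finite_odd_field F \<and>
     (few_even_tuples F \<longrightarrow> (\<forall>F' :: int ring. finite_odd_field F' \<longrightarrow> few_even_tuples F')))"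

lemma finite_odd_field_residue_ring:
  assumes "prime p" "odd p"
  shows "finite_odd_field (residue_ring (int p))" "card (carrier (residue_ring (int p))) = p"
proof -
  interpret residues_prime p "residue_ring (int p)" by unfold_locales (use assms in auto)
  show "card (carrier (residue_ring (int p))) = p" by (simp add: residue_ring_def)
  thus "finite_odd_field (residue_ring (int p))"
    using is_field assms by (simp add: finite_odd_field_def residue_ring_def)
qed

lemma
  shows finite_odd_field_critical_ring: "finite_odd_field critical_ring"
    and critical_ring_decides: "few_even_tuples critical_ring \<Longrightarrow> finite_odd_field (F :: int ring) \<Longrightarrow> few_even_tuples F"
proof -
  obtain p :: nat where "prime p" "p > 2" using bigger_prime by blast
  hence "\<exists>F :: int ring. finite_odd_field F"
    using finite_odd_field_residue_ring(1) prime_odd_nat by blast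
  hence "\<exists>F :: int ring. finite_odd_field F \<and>
     (few_even_tuples F \<longrightarrow> (\<forall>F' :: int ring. finite_odd_field F' \<longrightarrow> few_even_tuples F'))"
    by blast
  from someI_ex[OF this, folded critical_ring_def]
  show "finite_odd_field critical_ring"
    "few_even_tuples critical_ring \<Longrightarrow> finite_odd_field (F :: int ring) \<Longrightarrow> few_even_tuples F" by auto
qed

interpretation crit: field critical_ring
  using finite_odd_field_critical_ring by (simp add: finite_odd_field_def)

typedef critical = "carrier critical_ring"
  using crit.zero_closed by blast

instantiation critical :: field
begin

definition zero_critical :: critical where "0 = Abs_critical \<zero>\<^bsub>critical_ring\<^esub>"
definition one_critical :: critical where "1 = Abs_critical \<one>\<^bsub>critical_ring\<^esub>"
definition plus_critical :: "critical \<Rightarrow> critical \<Rightarrow> critical" where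
  "x + y = Abs_critical (Rep_critical x \<oplus>\<^bsub>critical_ring\<^esub> Rep_critical y)"
definition times_critical :: "critical \<Rightarrow> critical \<Rightarrow> critical" where
  "x * y = Abs_critical (Rep_critical x \<otimes>\<^bsub>critical_ring\<^esub> Rep_critical y)"
definition uminus_critical :: "critical \<Rightarrow> critical" where
  "- x = Abs_critical (\<ominus>\<^bsub>critical_ring\<^esub> Rep_critical x)"
definition minus_critical :: "critical \<Rightarrow> critical \<Rightarrow> critical" where
  "x - y = x + - (y :: critical)"
definition inverse_critical :: "critical \<Rightarrow> critical" where
  "inverse x = (if x = 0 then 0 else Abs_critical (inv\<^bsub>critical_ring\<^esub> Rep_critical x))"
definition divide_critical :: "critical \<Rightarrow> critical \<Rightarrow> critical" where
  "x div y = x * inverse (y :: critical)"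

lemma Rep_critical_ops:
  "Rep_critical 0 = \<zero>\<^bsub>critical_ring\<^esub>"
  "Rep_critical 1 = \<one>\<^bsub>critical_ring\<^esub>"
  "Rep_critical (x + y) = Rep_critical x \<oplus>\<^bsub>critical_ring\<^esub> Rep_critical y"
  "Rep_critical (x * y) = Rep_critical x \<otimes>\<^bsub>critical_ring\<^esub> Rep_critical y"
  "Rep_critical (- x) = \<ominus>\<^bsub>critical_ring\<^esub> Rep_critical x"
  by (simp_all add: zero_critical_def one_critical_def plus_critical_def times_critical_def
      uminus_critical_def Abs_critical_inverse Rep_critical)

instance
proof
  fix a b c :: critical
  note [simp] = Rep_critical Rep_critical_ops Rep_critical_inject[symmetric]
  show "a * b * c = a * (b * c)" by (simp add: crit.m_assoc)
  show "a * b = b * a" by (simp add: crit.m_comm)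
  show "1 * a = a" by simp
  show "a + b + c = a + (b + c)" by (simp add: crit.a_assoc)
  show "a + b = b + a" by (simp add: crit.a_comm)
  show "0 + a = a" by simp
  show "- a + a = 0" by (simp add: crit.l_neg)
  show "a - b = a + - b" by (rule minus_critical_def)
  show "(a + b) * c = a * c + b * c" by (simp add: crit.l_distr)
  show "(0 :: critical) \<noteq> 1" by simp
  show "inverse (0 :: critical) = 0" by (simp add: inverse_critical_def)
  show "a div b = a * inverse b" by (rule divide_critical_def)
  show "inverse a * a = 1" if "a \<noteq> 0"
  proof -
    have u: "Rep_critical a \<in> Units critical_ring"
      using that by (simp add: crit.field_Units)
    thus ?thesis
      using that by (simp add: inverse_critical_def Abs_critical_inverse crit.Units_inv_closed)
  qed
qed

end

instance critical :: finite_field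
proof (rule finite_fieldI)
  show "finite (UNIV :: critical set)"
    using finite_odd_field_critical_ring
    by (simp add: finite_odd_field_def type_definition.univ[OF type_definition_critical])
qed

lemma few_even_tuples_critical_ring: "few_even_tuples critical_ring"
proof (rule few_even_tuples_ring_iso)
  show "cring critical_ring" by (rule crit.is_cring)
  show "cring (type_ring :: critical ring)" by (rule cring_type_ring)
  show "finite (carrier critical_ring)"
    using finite_odd_field_critical_ring by (simp add: finite_odd_field_def)
  have "CARD(critical) = card (carrier critical_ring)"
    by (rule type_definition.card[OF type_definition_critical])
  thus "few_even_tuples (type_ring :: critical ring)"
    using finite_odd_field_critical_ring
    by (intro few_even_tuples_type_ring) (simp add: finite_odd_field_def)
  show "Abs_critical \<in> ring_iso critical_ring (type_ring :: critical ring)"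
  proof (rule ring_iso_memI)
    show "bij_betw Abs_critical (carrier critical_ring) (carrier type_ring)"
      by (rule bij_betwI[of _ _ _ Rep_critical])
        (auto simp: Rep_critical Rep_critical_inverse Abs_critical_inverse)
  qed (auto simp: times_critical_def plus_critical_def one_critical_def Abs_critical_inverse)
qed

theorem few_even_tuples_finite_odd_field:
  assumes "finite_odd_field F"
  shows "few_even_tuples F"
proof -
  have F: "field F" "finite (carrier F)" using assms by (auto simp: finite_odd_field_def)
  interpret F: field F by (rule F(1))
  obtain g :: "_ \<Rightarrow> int" where g: "inj_on g (carrier F)"
    using finite_imp_inj_to_nat_seg[OF F(2)] by (metis comp_inj_on inj_of_nat inj_on_subset subset_UNIV)
  define F' where "F' = image_ring g F"
  have iso: "g \<in> ring_iso F F'" unfolding F'_def by (rule inj_imp_image_ring_iso[OF g])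
  have F': "field F'" unfolding F'_def by (rule F.inj_imp_image_ring_is_field[OF g])
  have "card (carrier F) = card (carrier F')"
    using ring_iso_memE(5)[OF iso] by (rule bij_betw_same_card)
  moreover have "finite (carrier F')"
    using F(2) ring_iso_memE(5)[OF iso] bij_betw_finite by blast
  ultimately have "finite_odd_field F'" using assms F' by (simp add: finite_odd_field_def)
  hence "few_even_tuples F'"
    by (rule critical_ring_decides[OF few_even_tuples_critical_ring])
  moreover have "cring F'" using F' by (simp add: field_def domain_def)
  ultimately show ?thesis
    using few_even_tuples_ring_iso[OF F.is_cring _ iso F(2)] by blast
qed

section \<open>Even partial octahedra\<close>
lemma verts_Y_hypergraph: "verts (Y_hypergraph k f F) = carrier F"
  by (simp add: Y_hypergraph_def)

lemma k_uniform_Y_hypergraph: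
  assumes "finite (carrier F)"
  shows "k_uniform k (Y_hypergraph k f F)"
  using assms by (auto simp: k_uniform_def Y_hypergraph_def card_image)

text \<open>
  An edge is a set, and it may come from another enumeration than $b$. The product does not
  depend on the enumeration.
\<close>
lemma image_in_edges_Y_hypergraph_iff:
  assumes F: "cring F" and b: "b \<in> {1..k} \<rightarrow> carrier F" "inj_on b {1..k}"
  shows "b ` {1..k} \<in> edges (Y_hypergraph k (prod_plus_one k F) F) \<longleftrightarrow>
    is_square_in F (prod_plus_one k F b)"
proof
  assume "is_square_in F (prod_plus_one k F b)"
  thus "b ` {1..k} \<in> edges (Y_hypergraph k (prod_plus_one k F) F)"
    using b by (auto simp: Y_hypergraph_def)
next
  interpret F: cring F by (rule F)
  assume "b ` {1..k} \<in> edges (Y_hypergraph k (prod_plus_one k F) F)"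
  then obtain a where a: "a \<in> {1..k} \<rightarrow> carrier F" "inj_on a {1..k}"
    and eq: "b ` {1..k} = a ` {1..k}" and sq: "is_square_in F (prod_plus_one k F a)"
    by (auto simp: Y_hypergraph_def)
  have prod_image: "(\<Otimes>\<^bsub>F\<^esub>x\<in>c ` {1..k}. x) = (\<Otimes>\<^bsub>F\<^esub>i\<in>{1..k}. c i)"
    if "c \<in> {1..k} \<rightarrow> carrier F" "inj_on c {1..k}" for c
    using that by (intro F.finprod_reindex) auto
  have "prod_plus_one k F b = prod_plus_one k F a"
    unfolding prod_plus_one_def prod_image[OF a, symmetric] prod_image[OF b, symmetric] eq ..
  thus "is_square_in F (prod_plus_one k F b)" using sq by simp
qed

lemma octahedron_edges_bij:
  "bij_betw (\<lambda>\<epsilon>. (\<lambda>i. (i, \<epsilon> i)) ` {1..k}) ({1..k} \<rightarrow>\<^sub>E {0, 1}) (edges (octahedron k))"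
  unfolding bij_betw_def
proof
  show "inj_on (\<lambda>\<epsilon>. (\<lambda>i. (i, \<epsilon> i)) ` {1..k}) ({1..k} \<rightarrow>\<^sub>E {0, 1::nat})"
  proof (rule inj_onI)
    fix \<epsilon> \<epsilon>' :: "nat \<Rightarrow> nat"
    assume P: "\<epsilon> \<in> {1..k} \<rightarrow>\<^sub>E {0, 1}" "\<epsilon>' \<in> {1..k} \<rightarrow>\<^sub>E {0, 1}"
      and eq: "(\<lambda>i. (i, \<epsilon> i)) ` {1..k} = (\<lambda>i. (i, \<epsilon>' i)) ` {1..k}"
    show "\<epsilon> = \<epsilon>'"
    proof (rule PiE_ext[OF P])
      fix i assume "i \<in> {1..k}"
      hence "(i, \<epsilon> i) \<in> (\<lambda>i. (i, \<epsilon>' i)) ` {1..k}" unfolding eq[symmetric] by blast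
      thus "\<epsilon> i = \<epsilon>' i" by auto
    qed
  qed
  show "(\<lambda>\<epsilon>. (\<lambda>i. (i, \<epsilon> i)) ` {1..k}) ` ({1..k} \<rightarrow>\<^sub>E {0, 1}) = edges (octahedron k)"
  proof (intro equalityI subsetI)
    fix S assume "S \<in> edges (octahedron k)"
    then obtain \<epsilon> where \<epsilon>: "\<epsilon> \<in> {1..k} \<rightarrow> {0, 1}" and S: "S = (\<lambda>i. (i, \<epsilon> i)) ` {1..k}"
      by (auto simp: octahedron_def)
    have "S = (\<lambda>i. (i, restrict \<epsilon> {1..k} i)) ` {1..k}"
      unfolding S by (rule image_cong) auto
    moreover have "restrict \<epsilon> {1..k} \<in> {1..k} \<rightarrow>\<^sub>E {0, 1}"
      using \<epsilon> by (simp add: restrict_PiE_iff Pi_iff)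
    ultimately show "S \<in> (\<lambda>\<epsilon>. (\<lambda>i. (i, \<epsilon> i)) ` {1..k}) ` ({1..k} \<rightarrow>\<^sub>E {0, 1})" by blast
  next
    fix S :: "(nat \<times> nat) set" assume "S \<in> (\<lambda>\<epsilon>. (\<lambda>i. (i, \<epsilon> i)) ` {1..k}) ` ({1..k} \<rightarrow>\<^sub>E {0, 1})"
    then obtain \<epsilon> where "\<epsilon> \<in> {1..k} \<rightarrow>\<^sub>E {0, 1}" and S: "S = (\<lambda>i. (i, \<epsilon> i)) ` {1..k}" by blast
    hence "\<epsilon> \<in> {1..k} \<rightarrow> {0, 1}" by (simp add: PiE_def)
    thus "S \<in> edges (octahedron k)" unfolding S octahedron_def by auto
  qed
qed

lemma image_filter_eq: "A \<inter> f ` C = f ` {x\<in>C. f x \<in> A}"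
  by blast

lemma induced_embedding_in_even_tuples:
  assumes F: "cring F" and H: "H \<in> even_partial_octahedra k"
    and \<phi>: "\<phi> \<in> induced_embeddings k H (Y_hypergraph k (prod_plus_one k F) F)"
  shows "\<phi> \<in> even_tuples k F"
proof -
  let ?Y = "Y_hypergraph k (prod_plus_one k F) F"
  let ?C = "{1..k} \<rightarrow>\<^sub>E {0, 1::nat}"
  let ?e = "\<lambda>\<epsilon>. (\<lambda>i. (i, \<epsilon> i)) ` {1..k}"
  have vH: "verts H = {1..k} \<times> {0, 1}" and ev: "even (card (edges H \<inter> edges (octahedron k)))"
    using H by (auto simp: even_partial_octahedra_def octahedron_def)
  have P: "\<phi> \<in> ({1..k} \<times> {0, 1}) \<rightarrow>\<^sub>E carrier F" and inj: "inj_on \<phi> ({1..k} \<times> {0, 1})"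
    and ind: "\<And>S. S \<subseteq> {1..k} \<times> {0, 1} \<Longrightarrow> card S = k \<Longrightarrow> S \<in> edges H \<longleftrightarrow> \<phi> ` S \<in> edges ?Y"
    using \<phi> by (auto simp: induced_embeddings_def vH Y_hypergraph_def)
  have iff: "?e \<epsilon> \<in> edges H \<longleftrightarrow> is_square_in F (prod_plus_one k F (\<lambda>i. \<phi> (i, \<epsilon> i)))"
    if \<epsilon>: "\<epsilon> \<in> ?C" for \<epsilon>
  proof -
    have inV: "(i, \<epsilon> i) \<in> {1..k} \<times> {0, 1}" if "i \<in> {1..k}" for i
      using PiE_mem[OF \<epsilon> that] that by blast
    have "card (?e \<epsilon>) = k" by (subst card_image) (auto simp: inj_on_def)
    moreover have "?e \<epsilon> \<subseteq> {1..k} \<times> {0, 1}" using inV by blast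
    ultimately have "?e \<epsilon> \<in> edges H \<longleftrightarrow> \<phi> ` ?e \<epsilon> \<in> edges ?Y" by (intro ind)
    moreover have "\<phi> ` ?e \<epsilon> = (\<lambda>i. \<phi> (i, \<epsilon> i)) ` {1..k}" by (rule image_image)
    moreover have "(\<lambda>i. \<phi> (i, \<epsilon> i)) ` {1..k} \<in> edges ?Y \<longleftrightarrow>
        is_square_in F (prod_plus_one k F (\<lambda>i. \<phi> (i, \<epsilon> i)))"
    proof (rule image_in_edges_Y_hypergraph_iff[OF F])
      show "(\<lambda>i. \<phi> (i, \<epsilon> i)) \<in> {1..k} \<rightarrow> carrier F" using inV PiE_mem[OF P] by blast
      show "inj_on (\<lambda>i. \<phi> (i, \<epsilon> i)) {1..k}"
        using inj_onD[OF inj _ inV inV] by (intro inj_onI) blast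
    qed
    ultimately show ?thesis by metis
  qed
  have inj_e: "inj_on ?e ?C" and im_e: "?e ` ?C = edges (octahedron k)"
    using octahedron_edges_bij[of k] by (simp_all only: bij_betw_def)
  have "edges H \<inter> edges (octahedron k) = ?e ` {\<epsilon>\<in>?C. ?e \<epsilon> \<in> edges H}"
    unfolding im_e[symmetric] by (rule image_filter_eq)
  hence "card (edges H \<inter> edges (octahedron k)) = card (?e ` {\<epsilon>\<in>?C. ?e \<epsilon> \<in> edges H})"
    by (rule arg_cong)
  also have "\<dots> = card {\<epsilon>\<in>?C. ?e \<epsilon> \<in> edges H}"
    by (rule card_image, rule inj_on_subset[OF inj_e]) simp
  finally have "even (card {\<epsilon>\<in>?C. ?e \<epsilon> \<in> edges H})" using ev by metis
  moreover have "{\<epsilon>\<in>?C. ?e \<epsilon> \<in> edges H} =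
      {\<epsilon>\<in>?C. is_square_in F (prod_plus_one k F (\<lambda>i. \<phi> (i, \<epsilon> i)))}"
    using iff by blast
  ultimately show ?thesis
    using P unfolding even_tuples_def by simp
qed

lemma finite_even_partial_octahedra: "finite (even_partial_octahedra k)"
proof -
  let ?V = "verts (octahedron k)"
  have "finite ?V" by (simp add: octahedron_def)
  moreover have "even_partial_octahedra k \<subseteq> (\<lambda>E. \<lparr>verts = ?V, edges = E\<rparr>) ` Pow (Pow ?V)"
  proof
    fix H assume "H \<in> even_partial_octahedra k"
    hence "verts H = ?V" "edges H \<in> Pow (Pow ?V)"
      by (auto simp: even_partial_octahedra_def k_uniform_def)
    thus "H \<in> (\<lambda>E. \<lparr>verts = ?V, edges = E\<rparr>) ` Pow (Pow ?V)"
      by (intro image_eqI[of _ _ "edges H"]) simp_all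
  qed
  ultimately show ?thesis by (meson finite_Pow_iff finite_imageI finite_subset)
qed

text \<open>
  An induced embedding determines the edges of its source, so no tuple is counted for two
  different even partial octahedra.
\<close>
lemma induced_embeddings_disjoint:
  assumes H: "H \<in> even_partial_octahedra k" "H' \<in> even_partial_octahedra k"
    and \<phi>: "\<phi> \<in> induced_embeddings k H G" "\<phi> \<in> induced_embeddings k H' G"
  shows "H = H'"
proof -
  have v: "verts H = verts H'" using H by (simp add: even_partial_octahedra_def)
  have "S \<in> edges H \<longleftrightarrow> S \<in> edges H'" for S
  proof (cases "S \<subseteq> verts H \<and> card S = k")
    case True
    thus ?thesis using \<phi> v by (simp add: induced_embeddings_def)
  next
    case False
    have "k_uniform k H" "k_uniform k H'" using H by (simp_all add: even_partial_octahedra_def)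
    thus ?thesis using False unfolding k_uniform_def v by blast
  qed
  thus ?thesis using v by (intro hypergraph.equality) auto
qed

lemma finite_even_tuples: "finite (carrier F) \<Longrightarrow> finite (even_tuples k F)"
  by (rule finite_subset[of _ "({1..k} \<times> {0, 1}) \<rightarrow>\<^sub>E carrier F"])
    (auto simp: even_tuples_def intro!: finite_PiE)

lemma EPO_count_le_card_even_tuples:
  assumes F: "cring F" and fin: "finite (carrier F)"
  shows "EPO_count k (Y_hypergraph k (prod_plus_one k F) F) \<le> card (even_tuples k F)"
proof -
  let ?I = "\<lambda>H. induced_embeddings k H (Y_hypergraph k (prod_plus_one k F) F)"
  have sub: "(\<Union>H\<in>even_partial_octahedra k. ?I H) \<subseteq> even_tuples k F"
    using induced_embedding_in_even_tuples[OF F] by blast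
  have "EPO_count k (Y_hypergraph k (prod_plus_one k F) F) =
      (\<Sum>H\<in>even_partial_octahedra k. card (?I H))"
    by (simp add: EPO_count_def induced_count_def)
  also have "\<dots> = card (\<Union>H\<in>even_partial_octahedra k. ?I H)"
  proof (rule card_UN_disjoint[symmetric])
    show "\<forall>H\<in>even_partial_octahedra k. finite (?I H)"
      using sub finite_even_tuples[OF fin] by (meson UN_subset_iff finite_subset)
    show "\<forall>H\<in>even_partial_octahedra k. \<forall>H'\<in>even_partial_octahedra k. H \<noteq> H' \<longrightarrow> ?I H \<inter> ?I H' = {}"
      using induced_embeddings_disjoint by blast
  qed (rule finite_even_partial_octahedra)
  also have "\<dots> \<le> card (even_tuples k F)"
    by (rule card_mono[OF finite_even_tuples[OF fin] sub])
  finally show ?thesis .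
qed

lemma card_even_tuples_le_power:
  assumes "finite (carrier F)"
  shows "card (even_tuples k F) \<le> card (carrier F) ^ (2 * k)"
proof -
  have "card (even_tuples k F) \<le> card (({1..k} \<times> {0, 1::nat}) \<rightarrow>\<^sub>E carrier F)"
    using assms by (intro card_mono finite_PiE) (auto simp: even_tuples_def)
  also have "\<dots> = card (carrier F) ^ (2 * k)"
    by (simp add: card_PiE card_cartesian_product mult_2)
  finally show ?thesis .
qed

section \<open>Quasi-randomness\<close>

text \<open>
  For every $n$ the error term is the largest relative excess among the members with $n$ vertices,
  or zero if that is larger. The trivial bound keeps the supremum finite for small $n$.
\<close>
lemma quasi_randomI:
  fixes \<G> :: "'a hypergraph set"
  assumes unif: "\<And>G. G \<in> \<G> \<Longrightarrow> k_uniform k G"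
    and unbounded: "\<And>N. \<exists>G\<in>\<G>. card (verts G) \<ge> N"
    and triv: "\<And>G. G \<in> \<G> \<Longrightarrow> EPO_count k G \<le> card (verts G) ^ (2 * k)"
    and bound: "\<And>\<eta>. \<eta> > 0 \<Longrightarrow> \<exists>q0. \<forall>G\<in>\<G>. card (verts G) \<ge> q0 \<longrightarrow>
      real (EPO_count k G) \<le> (1 + \<eta>) * (real (card (verts G)) ^ (2 * k) / 2)"
  shows "quasi_random k \<G>"
proof -
  define excess where "excess = (\<lambda>G :: 'a hypergraph. 2 * real (EPO_count k G) / real (card (verts G)) ^ (2 * k) - 1)"
  define X where "X = (\<lambda>n. insert 0 (excess ` {G\<in>\<G>. card (verts G) = n}))"
  define \<delta> where "\<delta> = (\<lambda>n. Sup (X n))"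
  have relative: "2 * e / P - 1 \<le> s" if "e \<le> (1 + s) * (P / 2)" "P \<ge> 0" "s \<ge> 0" for e P s :: real
    using that by (cases "P = 0") (auto simp: field_simps)
  have le1: "x \<le> 1" if "x \<in> X n" for x n
  proof -
    have "excess G \<le> 1" if "G \<in> \<G>" for G
    proof -
      have "real (EPO_count k G) \<le> real (card (verts G)) ^ (2 * k)"
        using triv[OF that] by (metis of_nat_le_iff of_nat_power)
      thus ?thesis unfolding excess_def by (intro relative) auto
    qed
    thus ?thesis using that by (auto simp: X_def)
  qed
  have bdd: "bdd_above (X n)" for n using le1 by (intro bdd_aboveI)
  have "\<delta> \<longlonglongrightarrow> 0"
  proof (rule LIMSEQ_I)
    fix r :: real assume "r > 0"
    then obtain q0 where q0: "\<And>G. G \<in> \<G> \<Longrightarrow> card (verts G) \<ge> q0 \<Longrightarrow>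
        real (EPO_count k G) \<le> (1 + r / 2) * (real (card (verts G)) ^ (2 * k) / 2)"
      using bound[of "r / 2"] by auto
    have "norm (\<delta> n - 0) < r" if n: "n \<ge> q0" for n
    proof -
      have "\<delta> n \<ge> 0" unfolding \<delta>_def by (rule cSup_upper[OF _ bdd]) (simp add: X_def)
      moreover have "\<delta> n \<le> r / 2" unfolding \<delta>_def
      proof (rule cSup_least)
        fix x assume "x \<in> X n"
        then consider "x = 0" | G where "G \<in> \<G>" "card (verts G) = n" "x = excess G"
          by (auto simp: X_def)
        thus "x \<le> r / 2"
        proof cases
          case 2
          have "real (EPO_count k G) \<le> (1 + r / 2) * (real n ^ (2 * k) / 2)"
            using q0[OF 2(1)] 2(2) n by simp
          thus ?thesis using \<open>r > 0\<close> unfolding 2(3) excess_def 2(2)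
            by (intro relative) auto
        qed (use \<open>r > 0\<close> in simp)
      qed (simp add: X_def)
      ultimately show ?thesis using \<open>r > 0\<close> by simp
    qed
    thus "\<exists>no. \<forall>n\<ge>no. norm (\<delta> n - 0) < r" by blast
  qed
  moreover have "real (EPO_count k G) \<le> (1 + \<delta> (card (verts G))) * (real (card (verts G)) ^ (2 * k) / 2)"
    if G: "G \<in> \<G>" for G
  proof -
    have "excess G \<le> \<delta> (card (verts G))"
      unfolding \<delta>_def by (rule cSup_upper[OF _ bdd]) (use G in \<open>auto simp: X_def\<close>)
    hence "(1 + excess G) * (real (card (verts G)) ^ (2 * k) / 2) \<le>
        (1 + \<delta> (card (verts G))) * (real (card (verts G)) ^ (2 * k) / 2)"
      by (intro mult_right_mono) auto
    moreover have "real (EPO_count k G) \<le> (1 + excess G) * (real (card (verts G)) ^ (2 * k) / 2)"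
    proof (cases "real (card (verts G)) ^ (2 * k) = 0")
      case True
      hence "card (verts G) ^ (2 * k) = 0" by (metis of_nat_eq_0_iff of_nat_power)
      hence "EPO_count k G = 0" using triv[OF G] by linarith
      thus ?thesis unfolding True by simp
    qed (simp add: excess_def)
    ultimately show ?thesis by linarith
  qed
  ultimately show ?thesis unfolding quasi_random_def using unif unbounded by blast
qed

text \<open>
  The main term of the bound is $q^{2k} (J + d) / (2 J - 1)$, where
  $(J + d) / (2 J - 1) = 1/2 + (2 d + 1) / (2 (2 J - 1))$. First $J$ is chosen to make the second
  summand at most $\eta / 4$, and then $q$ large enough for all lower-order terms to
  contribute at most $\eta / 4$.
\<close>
lemma even_tuples_asymptotic:
  assumes k: "k \<ge> 2" and \<eta>: "\<eta> > 0"
  shows "\<exists>q0. \<forall>F :: 'a ring. finite_odd_field F \<longrightarrow> card (carrier F) \<ge> q0 \<longrightarrow>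
    real (card (even_tuples k F)) \<le> (1 + \<eta>) * (real (card (carrier F)) ^ (2 * k) / 2)"
proof -
  define d where "d = (2 ^ k :: nat)"
  define C where "C = 2 * 2 ^ k + k"
  obtain J :: nat where J: "real J > real (2 * d + 1) / \<eta> + 1"
    using reals_Archimedean2 by blast
  have J0: "J > 0" using J \<eta> by (cases J) (auto simp: field_simps add_pos_nonneg dest: less_trans)
  obtain q1 :: nat where q1: "real q1 > 4 * real C / \<eta>"
    using reals_Archimedean2 by blast
  show ?thesis
  proof (intro exI[of _ "max q1 (2 ^ k + 3 + 4 * J\<^sup>2 * (2 * 2 ^ k + 1))"] allI impI)
    fix F :: "'a ring"
    assume F: "finite_odd_field F"
      and large: "max q1 (2 ^ k + 3 + 4 * J\<^sup>2 * (2 * 2 ^ k + 1)) \<le> card (carrier F)"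
    define q where "q = card (carrier F)"
    define N where "N = card (even_tuples k F)"
    have q: "q > 0" using large by (simp add: q_def)
    have main: "(2 * J - 1) * N \<le> ((J + d) * q + (2 * J - 1) * C) * q ^ (2 * k - 1)"
      using few_even_tuples_finite_odd_field[OF F] k J0 large
      unfolding few_even_tuples_def Let_def q_def N_def d_def C_def by simp
    define L where "L = 2 * real J - 1"
    have L: "L > 0" "real (2 * J - 1) = L" using J0 by (auto simp: L_def of_nat_diff)
    have "L * real N \<le> ((real J + real d) * real q + L * real C) * real q ^ (2 * k - 1)"
      using of_nat_mono[OF main, where ?'a = real] unfolding of_nat_mult of_nat_add of_nat_power L(2) .
    also have "\<dots> = L * (((real J + real d) / L + real C / real q) * (real q * real q ^ (2 * k - 1)))"
      using L q by (simp add: field_simps)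
    also have "real q * real q ^ (2 * k - 1) = real q ^ (2 * k)"
      using k by (simp flip: power_Suc)
    finally have "real N \<le> ((real J + real d) / L + real C / real q) * real q ^ (2 * k)"
      using L by simp
    also have "\<dots> \<le> ((1 + \<eta>) / 2) * real q ^ (2 * k)"
    proof (rule mult_right_mono)
      have "real q \<ge> real q1" using large by (simp add: q_def)
      hence "4 * real C / \<eta> < real q" using q1 by linarith
      hence "real C / real q \<le> \<eta> / 4" using \<eta> q by (simp add: field_simps)
      moreover have "(real J + real d) / L \<le> 1 / 2 + \<eta> / 4"
      proof -
        have "real (2 * d + 1) / \<eta> < real J - 1" using J by linarith
        hence "real (2 * d + 1) < (real J - 1) * \<eta>" using \<eta> by (simp add: field_simps)
        also have "\<dots> \<le> (L / 2) * \<eta>" using \<eta> by (intro mult_right_mono) (auto simp: L_def)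
        finally have "2 * real d + 1 \<le> (L / 2) * \<eta>" by simp
        moreover have "real J + real d = L / 2 + (2 * real d + 1) / 2" by (simp add: L_def field_simps)
        ultimately have "real J + real d \<le> L / 2 + (L / 2) * \<eta> / 2" by (simp add: field_simps)
        also have "\<dots> = (1 / 2 + \<eta> / 4) * L" by (simp add: field_simps)
        finally show ?thesis using L by (simp add: pos_divide_le_eq)
      qed
      ultimately show "(real J + real d) / L + real C / real q \<le> (1 + \<eta>) / 2" by argo
    qed simp
    finally show "real (card (even_tuples k F)) \<le> (1 + \<eta>) * (real (card (carrier F)) ^ (2 * k) / 2)"
      by (simp add: N_def q_def)
  qed
qed

lemma exists_large_finite_odd_field:
  assumes "infinite (UNIV :: 'a set)"
  shows "\<exists>F :: 'a ring. finite_odd_field F \<and> primepow (card (carrier F)) \<and> card (carrier F) \<ge> N"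
proof -
  obtain p where p: "prime p" "p > max N 2" using bigger_prime by blast
  let ?R = "residue_ring (int p)"
  have R: "finite_odd_field ?R" "card (carrier ?R) = p"
    using p prime_odd_nat by (auto intro!: finite_odd_field_residue_ring)
  obtain S :: "'a set" where S: "finite S" "card S = p"
    using infinite_arbitrarily_large[OF assms] by blast
  then obtain g where g: "bij_betw g (carrier ?R) S"
    using R finite_same_card_bij[of "carrier ?R" S] by (auto simp: finite_odd_field_def)
  hence inj: "inj_on g (carrier ?R)" and im: "g ` carrier ?R = S" by (auto simp: bij_betw_def)
  interpret field ?R using R by (simp add: finite_odd_field_def)
  have "field (image_ring g ?R)" by (rule inj_imp_image_ring_is_field[OF inj])
  moreover have "carrier (image_ring g ?R) = S" unfolding image_ring_carrier by (rule im)
  ultimately have "finite_odd_field (image_ring g ?R) \<and>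
      primepow (card (carrier (image_ring g ?R))) \<and> card (carrier (image_ring g ?R)) \<ge> N"
    using S p R by (simp add: finite_odd_field_def primepow_prime)
  thus ?thesis by blast
qed

theorem corollary1p5:
  fixes k :: nat
  assumes "k \<ge> 2"
    and "infinite (UNIV :: 'a set)"
  shows "quasi_random k (D_family k :: 'a hypergraph set)"
proof (rule quasi_randomI)
  have D: "\<exists>F. finite_odd_field F \<and> finite (carrier F) \<and> verts G = carrier F \<and>
      k_uniform k G \<and> EPO_count k G \<le> card (even_tuples k F)"
    if "G \<in> D_family k" for G :: "'a hypergraph"
  proof -
    from that obtain F where F: "finite_odd_field F"
      and G: "G = Y_hypergraph k (prod_plus_one k F) F"
      by (auto simp: D_family_def finite_odd_field_def)
    have fin: "finite (carrier F)" and cring: "cring F"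
      using F by (auto simp: finite_odd_field_def field_def domain_def)
    thus ?thesis
      using F EPO_count_le_card_even_tuples[OF cring fin] k_uniform_Y_hypergraph[OF fin] fin
      unfolding G by (intro exI[of _ F]) (simp add: verts_Y_hypergraph)
  qed
  {
    fix G :: "'a hypergraph" assume "G \<in> D_family k"
    from D[OF this] show "k_uniform k G" by blast
  next
    fix G :: "'a hypergraph" assume "G \<in> D_family k"
    from D[OF this] show "EPO_count k G \<le> card (verts G) ^ (2 * k)"
      using card_even_tuples_le_power order.trans by metis
  next
    fix N
    obtain F :: "'a ring" where F: "finite_odd_field F" "primepow (card (carrier F))"
      "card (carrier F) \<ge> N"
      using exists_large_finite_odd_field[OF assms(2)] by blast
    have "Y_hypergraph k (prod_plus_one k F) F \<in> D_family k"
      using F(1,2) unfolding D_family_def finite_odd_field_def by blast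
    thus "\<exists>G\<in>(D_family k :: 'a hypergraph set). card (verts G) \<ge> N"
      using F(3) by (intro bexI) (simp_all add: verts_Y_hypergraph)
  next
    fix \<eta> :: real assume "\<eta> > 0"
    then obtain q0 where q0: "\<And>F :: 'a ring. finite_odd_field F \<Longrightarrow> card (carrier F) \<ge> q0 \<Longrightarrow>
        real (card (even_tuples k F)) \<le> (1 + \<eta>) * (real (card (carrier F)) ^ (2 * k) / 2)"
      using even_tuples_asymptotic[OF assms(1)] by blast
    show "\<exists>q0. \<forall>G\<in>(D_family k :: 'a hypergraph set). card (verts G) \<ge> q0 \<longrightarrow>
        real (EPO_count k G) \<le> (1 + \<eta>) * (real (card (verts G)) ^ (2 * k) / 2)"
    proof (intro exI[of _ q0] ballI impI)
      fix G :: "'a hypergraph" assume "G \<in> D_family k" and large: "card (verts G) \<ge> q0"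
      then obtain F where F: "finite_odd_field F" and v: "verts G = carrier F"
        and le: "EPO_count k G \<le> card (even_tuples k F)"
        using D by blast
      from le show "real (EPO_count k G) \<le> (1 + \<eta>) * (real (card (verts G)) ^ (2 * k) / 2)"
        using q0[OF F] large unfolding v by linarith
    qed
  }
qed

end
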